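(* Let $R$ be a ring, and let $I$ be a two-sided ideal of $R$. Then the following statements are equivalent: (i) There exists a projective right $R$-module $P$ such that $I=\mathrm{Tr}(P)$. (ii) For any finite subset $X$ of $I$ there exist finitely generated left ideals $J_1\subseteq J_2\subseteq I$ of $R$ such that $X\subseteq J_1$ and $J_2J_1=J_1$. (iii) There exists a left ideal $J\subseteq I$ of $R$ such that $JR=I$ and for any finite subset $X$ of $J$ there exist finitely generated left ideals $J_1\subseteq J_2\subseteq J$ such that $X\subseteq J_1$ and $J_2J_1=J_1$. Moreover, when these equivalent statements hold, $I$ is an $\aleph_1$-directed union of ideals of the form $\bigcup_{n\ge 1}J_nR$, where $J_1\subseteq J_2\subseteq\cdots\subseteq J_n\subseteq\cdots$ is a sequence of finitely generated left ideals of $R$ such that $J_{n+1}J_n=J_n$ for any $n\ge 1$.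
   Context: Rings are associative with $1$. The trace ideal of a right $R$-module $P$ is the two-sided ideal $\mathrm{Tr}(P)=\sum_{f\in \mathrm{Hom}_R(P,R)}f(P)$. For additive subgroups $A,B$ of $R$, $AB$ denotes the additive subgroup generated by all products $ab$ with $a\in A$, $b\in B$. A union of a family of ideals is $\aleph_1$-directed if every countable subfamily has an upper bound (with respect to inclusion) in the family. *)

theory Defs
  imports "HOL-Algebra.Ideal" "HOL-Algebra.Generated_Groups" "HOL-Library.Countable_Set"
begin

section \<open>Right modules over a noncommutative ring\<close>

text \<open>
  The library's locale of modules requires a commutative ring, so right modules are introduced
  here.  As for the library's modules, only the additive part of the underlying ring record
  is relevant.
\<close>

record ('a, 'm) rmodule = "'m ring" +
  rsmult :: "'m \<Rightarrow> 'a \<Rightarrow> 'm"  (infixl \<open>\<star>\<index>\<close> 70)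

locale right_module = R?: ring R + M?: abelian_group M
  for R :: "('a, 'c) ring_scheme" (structure)
    and M :: "('a, 'm, 'd) rmodule_scheme" (structure) +
  assumes rsmult_closed [simp, intro]:
      "\<lbrakk>x \<in> carrier M; r \<in> carrier R\<rbrakk> \<Longrightarrow> x \<star>\<^bsub>M\<^esub> r \<in> carrier M"
    and rsmult_add_scalar:
      "\<lbrakk>x \<in> carrier M; r \<in> carrier R; s \<in> carrier R\<rbrakk>
        \<Longrightarrow> x \<star>\<^bsub>M\<^esub> (r \<oplus>\<^bsub>R\<^esub> s) = x \<star>\<^bsub>M\<^esub> r \<oplus>\<^bsub>M\<^esub> x \<star>\<^bsub>M\<^esub> s"
    and rsmult_add:
      "\<lbrakk>x \<in> carrier M; y \<in> carrier M; r \<in> carrier R\<rbrakk>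
        \<Longrightarrow> (x \<oplus>\<^bsub>M\<^esub> y) \<star>\<^bsub>M\<^esub> r = x \<star>\<^bsub>M\<^esub> r \<oplus>\<^bsub>M\<^esub> y \<star>\<^bsub>M\<^esub> r"
    and rsmult_assoc:
      "\<lbrakk>x \<in> carrier M; r \<in> carrier R; s \<in> carrier R\<rbrakk>
        \<Longrightarrow> x \<star>\<^bsub>M\<^esub> (r \<otimes>\<^bsub>R\<^esub> s) = (x \<star>\<^bsub>M\<^esub> r) \<star>\<^bsub>M\<^esub> s"
    and rsmult_one [simp]: "x \<in> carrier M \<Longrightarrow> x \<star>\<^bsub>M\<^esub> \<one>\<^bsub>R\<^esub> = x"

definition rmod_hom ::
  "('a, 'c) ring_scheme \<Rightarrow> ('a, 'm, 'd) rmodule_scheme \<Rightarrow> ('a, 'n, 'e) rmodule_scheme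
    \<Rightarrow> ('m \<Rightarrow> 'n) set"
  where "rmod_hom R M N =
    {f \<in> carrier M \<rightarrow> carrier N.
       (\<forall>x \<in> carrier M. \<forall>y \<in> carrier M. f (x \<oplus>\<^bsub>M\<^esub> y) = f x \<oplus>\<^bsub>N\<^esub> f y) \<and>
       (\<forall>x \<in> carrier M. \<forall>r \<in> carrier R. f (x \<star>\<^bsub>M\<^esub> r) = f x \<star>\<^bsub>N\<^esub> r)}"

definition regular_rmodule :: "('a, 'c) ring_scheme \<Rightarrow> ('a, 'a) rmodule"
  where "regular_rmodule R =
    \<lparr>carrier = carrier R, mult = mult R, one = \<one>\<^bsub>R\<^esub>, zero = \<zero>\<^bsub>R\<^esub>, add = add R,
     rsmult = mult R\<rparr>"

definition lifts_along ::
  "('a, 'c) ring_scheme \<Rightarrow> ('a, 'p, 'x) rmodule_scheme \<Rightarrow> ('a, 'm, 'y) rmodule_scheme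
    \<Rightarrow> ('a, 'n, 'z) rmodule_scheme \<Rightarrow> bool"
  where "lifts_along R P M N \<longleftrightarrow>
    (\<forall>g \<in> rmod_hom R M N. \<forall>f \<in> rmod_hom R P N. g ` carrier M = carrier N \<longrightarrow>
      (\<exists>h \<in> rmod_hom R P M. \<forall>x \<in> carrier P. g (h x) = f x))"

text \<open>
  Projectivity is the lifting property against all epimorphisms of right modules.  As HOL
  cannot quantify over types inside a formula, the modules \<open>M\<close> and \<open>N\<close> range over fixed types
  that are large enough to contain the free module on the underlying set of \<open>P\<close>, and \<open>P\<close>
  itself.  This is no restriction: by \<open>projective_rmodule_lifts\<close> below, the lifting property then
  holds for right modules over arbitrary types.
\<close>

definition projective_rmodule :: "('a, 'c) ring_scheme \<Rightarrow> ('a, 'p) rmodule \<Rightarrow> bool"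
  where "projective_rmodule R P \<longleftrightarrow> right_module R P \<and>
    (\<forall>(M :: ('a, 'p \<Rightarrow> 'a) rmodule) (N :: ('a, 'p) rmodule).
       right_module R M \<longrightarrow> right_module R N \<longrightarrow> lifts_along R P M N)"

definition trace_ideal :: "('a, 'c) ring_scheme \<Rightarrow> ('a, 'p, 'd) rmodule_scheme \<Rightarrow> 'a set"
  where "trace_ideal R P =
    generate (add_monoid R) (\<Union>f \<in> rmod_hom R P (regular_rmodule R). f ` carrier P)"

text \<open>
  A trace ideal of a projective right module over any type is already the trace ideal of a
  direct summand of the free module on \<open>R \<times> \<nat>\<close>, since projective modules are direct sums of
  countably generated ones.  Hence \<open>'a \<times> nat \<Rightarrow> 'a\<close> is a large enough type for asserting the
  existence of a projective right module with a given trace ideal.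
\<close>


section \<open>Left ideals and products of additive subgroups\<close>

locale left_ideal = additive_subgroup J R + ring R for J and R (structure) +
  assumes l_closed: "\<lbrakk>a \<in> J; x \<in> carrier R\<rbrakk> \<Longrightarrow> x \<otimes> a \<in> J"

definition fg_left_ideal :: "'a set \<Rightarrow> ('a, 'c) ring_scheme \<Rightarrow> bool"
  where "fg_left_ideal J R \<longleftrightarrow>
    (\<exists>X \<subseteq> carrier R. finite X \<and> J = \<Inter>{L. left_ideal L R \<and> X \<subseteq> L})"

definition subgroup_prod :: "('a, 'c) ring_scheme \<Rightarrow> 'a set \<Rightarrow> 'a set \<Rightarrow> 'a set"
    (infixl \<open>\<bullet>\<index>\<close> 80)
  where "A \<bullet>\<^bsub>R\<^esub> B = generate (add_monoid R) {a \<otimes>\<^bsub>R\<^esub> b | a b. a \<in> A \<and> b \<in> B}"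

definition finite_subsets_covered :: "('a, 'c) ring_scheme \<Rightarrow> 'a set \<Rightarrow> bool"
  where "finite_subsets_covered R J \<longleftrightarrow>
    (\<forall>X. finite X \<and> X \<subseteq> J \<longrightarrow>
      (\<exists>J1 J2. fg_left_ideal J1 R \<and> fg_left_ideal J2 R \<and>
        J1 \<subseteq> J2 \<and> J2 \<subseteq> J \<and> X \<subseteq> J1 \<and> J2 \<bullet>\<^bsub>R\<^esub> J1 = J1))"

text \<open>The sequences below are indexed from \<open>0\<close> instead of \<open>1\<close>.\<close>

definition is_sequence_union :: "('a, 'c) ring_scheme \<Rightarrow> 'a set \<Rightarrow> bool"
  where "is_sequence_union R K \<longleftrightarrow>
    (\<exists>J :: nat \<Rightarrow> 'a set.
      (\<forall>n. fg_left_ideal (J n) R) \<and>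
      (\<forall>n. J n \<subseteq> J (Suc n)) \<and>
      (\<forall>n. J (Suc n) \<bullet>\<^bsub>R\<^esub> J n = J n) \<and>
      K = (\<Union>n. J n \<bullet>\<^bsub>R\<^esub> carrier R))"

definition aleph1_directed_union :: "'a set set \<Rightarrow> 'a set \<Rightarrow> bool"
  where "aleph1_directed_union F I \<longleftrightarrow>
    I = \<Union>F \<and> (\<forall>C \<subseteq> F. countable C \<longrightarrow> (\<exists>K \<in> F. \<forall>L \<in> C. L \<subseteq> K))"


section \<open>The lifting property over arbitrary types\<close>

definition free_rmodule :: "('a, 'c) ring_scheme \<Rightarrow> 's set \<Rightarrow> ('a, 's \<Rightarrow> 'a) rmodule"
  where "free_rmodule R S =
    \<lparr>carrier = {u. (\<forall>s. u s \<in> carrier R) \<and> {s. u s \<noteq> \<zero>\<^bsub>R\<^esub>} \<subseteq> S \<and> finite {s. u s \<noteq> \<zero>\<^bsub>R\<^esub>}},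
     mult = undefined, one = undefined,
     zero = (\<lambda>s. \<zero>\<^bsub>R\<^esub>), add = (\<lambda>u v s. u s \<oplus>\<^bsub>R\<^esub> v s),
     rsmult = (\<lambda>u r s. u s \<otimes>\<^bsub>R\<^esub> r)\<rparr>"

definition free_eval ::
  "('a, 'c) ring_scheme \<Rightarrow> ('a, 'n, 'd) rmodule_scheme \<Rightarrow> ('s \<Rightarrow> 'n) \<Rightarrow> ('s \<Rightarrow> 'a) \<Rightarrow> 'n"
  where "free_eval R N m u = (\<Oplus>\<^bsub>N\<^esub>s \<in> {s. u s \<noteq> \<zero>\<^bsub>R\<^esub>}. m s \<star>\<^bsub>N\<^esub> u s)"

lemma free_rmodule_add_supp:
  assumes "ring R" "u \<in> carrier (free_rmodule R S)" "v \<in> carrier (free_rmodule R S)"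
  shows "{s. u s \<oplus>\<^bsub>R\<^esub> v s \<noteq> \<zero>\<^bsub>R\<^esub>} \<subseteq> {s. u s \<noteq> \<zero>\<^bsub>R\<^esub>} \<union> {s. v s \<noteq> \<zero>\<^bsub>R\<^esub>}"
proof -
  interpret ring R by fact
  show ?thesis using assms by (auto simp: free_rmodule_def)
qed

lemma free_rmodule_smult_supp:
  assumes "ring R" "r \<in> carrier R"
  shows "{s. u s \<otimes>\<^bsub>R\<^esub> r \<noteq> \<zero>\<^bsub>R\<^esub>} \<subseteq> {s. u s \<noteq> \<zero>\<^bsub>R\<^esub>}"
proof -
  interpret ring R by fact
  show ?thesis using assms by auto
qed

lemma free_rmodule_right_module:
  fixes R (structure)
  assumes "ring R"
  shows "right_module R (free_rmodule R S)"
proof -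
  interpret ring R by fact
  let ?F = "free_rmodule R S"
  have ag: "abelian_group ?F"
  proof (rule abelian_groupI)
    fix u v assume u: "u \<in> carrier ?F" and v: "v \<in> carrier ?F"
    have "finite {s. u s \<oplus> v s \<noteq> \<zero>}" "{s. u s \<oplus> v s \<noteq> \<zero>} \<subseteq> S"
      using free_rmodule_add_supp[OF assms u v] u v
      by (auto intro: finite_subset simp: free_rmodule_def)
    then show "u \<oplus>\<^bsub>?F\<^esub> v \<in> carrier ?F" using u v by (simp add: free_rmodule_def)
  next
    fix u assume u: "u \<in> carrier ?F"
    have "{s. \<ominus> u s \<noteq> \<zero>} = {s. u s \<noteq> \<zero>}"
      using u by (auto simp: free_rmodule_def)
    then show "\<exists>v \<in> carrier ?F. v \<oplus>\<^bsub>?F\<^esub> u = \<zero>\<^bsub>?F\<^esub>" using u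
      by (intro bexI[of _ "\<lambda>s. \<ominus> u s"]) (auto simp: free_rmodule_def l_neg)
  next
    fix u v assume "u \<in> carrier ?F" "v \<in> carrier ?F"
    then show "u \<oplus>\<^bsub>?F\<^esub> v = v \<oplus>\<^bsub>?F\<^esub> u" by (simp add: free_rmodule_def a_comm)
  qed (simp_all add: free_rmodule_def a_assoc)
  show ?thesis
  proof (intro right_module.intro right_module_axioms.intro ag assms)
    fix u r assume u: "u \<in> carrier ?F" and r: "r \<in> carrier R"
    have "finite {s. u s \<otimes> r \<noteq> \<zero>}" "{s. u s \<otimes> r \<noteq> \<zero>} \<subseteq> S"
      using free_rmodule_smult_supp[OF assms r, of u] u
      by (auto intro: finite_subset simp: free_rmodule_def)
    then show "u \<star>\<^bsub>?F\<^esub> r \<in> carrier ?F" using u r by (simp add: free_rmodule_def)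
  qed (auto simp: free_rmodule_def r_distr l_distr m_assoc)
qed

lemma (in right_module) rsmult_zero_scalar [simp]:
  assumes "x \<in> carrier M" shows "x \<star>\<^bsub>M\<^esub> \<zero>\<^bsub>R\<^esub> = \<zero>\<^bsub>M\<^esub>"
proof -
  have "x \<star>\<^bsub>M\<^esub> \<zero>\<^bsub>R\<^esub> \<oplus>\<^bsub>M\<^esub> x \<star>\<^bsub>M\<^esub> \<zero>\<^bsub>R\<^esub> = x \<star>\<^bsub>M\<^esub> \<zero>\<^bsub>R\<^esub>"
    using rsmult_add_scalar[OF assms, of "\<zero>\<^bsub>R\<^esub>" "\<zero>\<^bsub>R\<^esub>"] by simp
  then show ?thesis using assms by (metis M.add.r_cancel_one R.zero_closed rsmult_closed)
qed

lemma (in right_module) rsmult_zero [simp]: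
  assumes "r \<in> carrier R" shows "\<zero>\<^bsub>M\<^esub> \<star>\<^bsub>M\<^esub> r = \<zero>\<^bsub>M\<^esub>"
proof -
  have "\<zero>\<^bsub>M\<^esub> \<star>\<^bsub>M\<^esub> r \<oplus>\<^bsub>M\<^esub> \<zero>\<^bsub>M\<^esub> \<star>\<^bsub>M\<^esub> r = \<zero>\<^bsub>M\<^esub> \<star>\<^bsub>M\<^esub> r"
    using rsmult_add[of "\<zero>\<^bsub>M\<^esub>" "\<zero>\<^bsub>M\<^esub>" r] assms by simp
  then show ?thesis using assms by (metis M.add.r_cancel_one M.zero_closed rsmult_closed)
qed

lemma (in right_module) finsum_rsmult:
  assumes "finite T" "f \<in> T \<rightarrow> carrier M" "r \<in> carrier R"
  shows "(\<Oplus>\<^bsub>M\<^esub>s \<in> T. f s) \<star>\<^bsub>M\<^esub> r = (\<Oplus>\<^bsub>M\<^esub>s \<in> T. f s \<star>\<^bsub>M\<^esub> r)"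
  using assms
  by (induction T rule: finite_induct) (auto simp: M.finsum_insert rsmult_add Pi_def)

lemma (in right_module) free_eval_superset:
  assumes "m \<in> S \<rightarrow> carrier M" "u \<in> carrier (free_rmodule R S)"
    and "finite T" "{s. u s \<noteq> \<zero>\<^bsub>R\<^esub>} \<subseteq> T" "T \<subseteq> S"
  shows "free_eval R M m u = (\<Oplus>\<^bsub>M\<^esub>s \<in> T. m s \<star>\<^bsub>M\<^esub> u s)"
  unfolding free_eval_def
  by (rule M.add.finprod_mono_neutral_cong_left)
     (use assms in \<open>auto simp: free_rmodule_def Pi_def subset_iff\<close>)

lemma (in right_module) free_eval_hom:
  assumes m: "m \<in> S \<rightarrow> carrier M"
  shows "free_eval R M m \<in> rmod_hom R (free_rmodule R S) M"
proof -
  let ?F = "free_rmodule R S"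
  interpret F: right_module R ?F by (rule free_rmodule_right_module) (rule R.ring_axioms)
  have supp: "finite {s. u s \<noteq> \<zero>\<^bsub>R\<^esub>}" "{s. u s \<noteq> \<zero>\<^bsub>R\<^esub>} \<subseteq> S" "\<And>s. u s \<in> carrier R"
    if "u \<in> carrier ?F" for u
    using that by (auto simp: free_rmodule_def)
  have closed: "free_eval R M m u \<in> carrier M" if "u \<in> carrier ?F" for u
    unfolding free_eval_def using supp[OF that] m by (intro M.finsum_closed) (auto simp: Pi_def)
  have add: "free_eval R M m (u \<oplus>\<^bsub>?F\<^esub> v) = free_eval R M m u \<oplus>\<^bsub>M\<^esub> free_eval R M m v"
    if u: "u \<in> carrier ?F" and v: "v \<in> carrier ?F" for u v
  proof -
    define T where "T = {s. u s \<noteq> \<zero>\<^bsub>R\<^esub>} \<union> {s. v s \<noteq> \<zero>\<^bsub>R\<^esub>}"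
    have T: "finite T" "T \<subseteq> S" using supp u v by (auto simp: T_def)
    have uv: "u \<oplus>\<^bsub>?F\<^esub> v = (\<lambda>s. u s \<oplus>\<^bsub>R\<^esub> v s)" by (simp add: free_rmodule_def)
    have "free_eval R M m (u \<oplus>\<^bsub>?F\<^esub> v) = (\<Oplus>\<^bsub>M\<^esub>s \<in> T. m s \<star>\<^bsub>M\<^esub> (u s \<oplus>\<^bsub>R\<^esub> v s))"
      using free_eval_superset[OF m F.a_closed[OF u v] T(1) _ T(2)]
        free_rmodule_add_supp[OF R.ring_axioms u v]
      by (simp add: uv T_def)
    also have "\<dots> = (\<Oplus>\<^bsub>M\<^esub>s \<in> T. m s \<star>\<^bsub>M\<^esub> u s \<oplus>\<^bsub>M\<^esub> m s \<star>\<^bsub>M\<^esub> v s)"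
      using m T supp(3)[OF u] supp(3)[OF v]
      by (intro M.finsum_cong') (auto simp: Pi_def subset_iff rsmult_add_scalar)
    also have "\<dots> = (\<Oplus>\<^bsub>M\<^esub>s \<in> T. m s \<star>\<^bsub>M\<^esub> u s) \<oplus>\<^bsub>M\<^esub> (\<Oplus>\<^bsub>M\<^esub>s \<in> T. m s \<star>\<^bsub>M\<^esub> v s)"
      using m T supp(3)[OF u] supp(3)[OF v]
      by (intro M.finsum_addf) (auto simp: Pi_def subset_iff)
    also have "\<dots> = free_eval R M m u \<oplus>\<^bsub>M\<^esub> free_eval R M m v"
      using free_eval_superset[OF m u T(1) _ T(2)] free_eval_superset[OF m v T(1) _ T(2)]
      by (simp add: T_def)
    finally show ?thesis .
  qed
  have smult: "free_eval R M m (u \<star>\<^bsub>?F\<^esub> r) = free_eval R M m u \<star>\<^bsub>M\<^esub> r"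
    if u: "u \<in> carrier ?F" and r: "r \<in> carrier R" for u r
  proof -
    define T where "T = {s. u s \<noteq> \<zero>\<^bsub>R\<^esub>}"
    have T: "finite T" "T \<subseteq> S" using supp u by (auto simp: T_def)
    have ur: "u \<star>\<^bsub>?F\<^esub> r = (\<lambda>s. u s \<otimes>\<^bsub>R\<^esub> r)" by (simp add: free_rmodule_def)
    have "free_eval R M m (u \<star>\<^bsub>?F\<^esub> r) = (\<Oplus>\<^bsub>M\<^esub>s \<in> T. m s \<star>\<^bsub>M\<^esub> (u s \<otimes>\<^bsub>R\<^esub> r))"
      using free_eval_superset[OF m F.rsmult_closed[OF u r] T(1) _ T(2)]
        free_rmodule_smult_supp[OF R.ring_axioms r, of u]
      by (simp add: ur T_def)
    also have "\<dots> = (\<Oplus>\<^bsub>M\<^esub>s \<in> T. (m s \<star>\<^bsub>M\<^esub> u s) \<star>\<^bsub>M\<^esub> r)"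
      using m T supp(3)[OF u] r
      by (intro M.finsum_cong') (auto simp: Pi_def subset_iff rsmult_assoc)
    also have "\<dots> = free_eval R M m u \<star>\<^bsub>M\<^esub> r"
      unfolding free_eval_def T_def[symmetric]
      using m T supp(3)[OF u] r by (intro finsum_rsmult[symmetric]) (auto simp: Pi_def subset_iff)
    finally show ?thesis .
  qed
  show ?thesis using closed add smult by (auto simp: rmod_hom_def)
qed

lemma rmod_hom_zero:
  assumes "right_module R M" "right_module R N" "g \<in> rmod_hom R M N"
  shows "g \<zero>\<^bsub>M\<^esub> = \<zero>\<^bsub>N\<^esub>"
proof -
  interpret M: right_module R M by fact
  interpret N: right_module R N by fact
  have "g \<zero>\<^bsub>M\<^esub> \<in> carrier N" using assms(3) by (auto simp: rmod_hom_def)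
  moreover have "g (\<zero>\<^bsub>M\<^esub> \<oplus>\<^bsub>M\<^esub> \<zero>\<^bsub>M\<^esub>) = g \<zero>\<^bsub>M\<^esub> \<oplus>\<^bsub>N\<^esub> g \<zero>\<^bsub>M\<^esub>"
    using assms(3) M.zero_closed unfolding rmod_hom_def by blast
  ultimately show ?thesis by simp
qed

lemma rmod_hom_finsum:
  assumes "right_module R M" "right_module R N" "g \<in> rmod_hom R M N"
    and "finite T" "f \<in> T \<rightarrow> carrier M"
  shows "g (\<Oplus>\<^bsub>M\<^esub>s \<in> T. f s) = (\<Oplus>\<^bsub>N\<^esub>s \<in> T. g (f s))"
proof -
  interpret M: right_module R M by fact
  interpret N: right_module R N by fact
  show ?thesis using assms(4,5)
  proof (induction T rule: finite_induct)
    case empty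
    then show ?case using rmod_hom_zero[OF assms(1-3)] by simp
  next
    case (insert s T)
    then have *: "f \<in> T \<rightarrow> carrier M" "f s \<in> carrier M" by auto
    then have "(\<lambda>s. g (f s)) \<in> T \<rightarrow> carrier N" "g (f s) \<in> carrier N"
      using assms(3) by (auto simp: rmod_hom_def)
    moreover have "g (f s \<oplus>\<^bsub>M\<^esub> finsum M f T) = g (f s) \<oplus>\<^bsub>N\<^esub> g (finsum M f T)"
      using assms(3) * M.finsum_closed[OF *(1)] unfolding rmod_hom_def by blast
    ultimately show ?case using insert * by (simp add: M.finsum_insert N.finsum_insert)
  qed
qed

lemma free_eval_comp:
  assumes M: "right_module R M" and N: "right_module R N" and g: "g \<in> rmod_hom R M N"
    and m: "m \<in> S \<rightarrow> carrier M" and u: "u \<in> carrier (free_rmodule R S)"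
  shows "g (free_eval R M m u) = free_eval R N (\<lambda>s. g (m s)) u"
proof -
  interpret M: right_module R M by fact
  interpret N: right_module R N by fact
  have T: "finite {s. u s \<noteq> \<zero>\<^bsub>R\<^esub>}" "{s. u s \<noteq> \<zero>\<^bsub>R\<^esub>} \<subseteq> S" "\<And>s. u s \<in> carrier R"
    using u by (auto simp: free_rmodule_def)
  have "g (free_eval R M m u) = (\<Oplus>\<^bsub>N\<^esub>s \<in> {s. u s \<noteq> \<zero>\<^bsub>R\<^esub>}. g (m s \<star>\<^bsub>M\<^esub> u s))"
    unfolding free_eval_def using T m
    by (intro rmod_hom_finsum[OF M N g]) (auto simp: Pi_def)
  also have "\<dots> = free_eval R N (\<lambda>s. g (m s)) u"
    unfolding free_eval_def using T m g
    by (intro N.M.finsum_cong') (auto simp: Pi_def rmod_hom_def subset_iff)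
  finally show ?thesis .
qed

lemma projective_rmodule_lifts:
  fixes P :: "('a, 'p) rmodule"
    and M :: "('a, 'm, 'y) rmodule_scheme" and N :: "('a, 'n, 'z) rmodule_scheme"
  assumes P: "projective_rmodule R P" and M: "right_module R M" and N: "right_module R N"
  shows "lifts_along R P M N"
  unfolding lifts_along_def
proof (intro ballI impI)
  fix g f assume g: "g \<in> rmod_hom R M N" and f: "f \<in> rmod_hom R P N"
    and surj: "g ` carrier M = carrier N"
  have Pm: "right_module R P" using P by (simp add: projective_rmodule_def)
  interpret P: right_module R P by fact
  interpret M: right_module R M by fact
  let ?F = "free_rmodule R (carrier P)"
  have Fm: "right_module R ?F" by (rule free_rmodule_right_module) (rule P.R.ring_axioms)
  let ?e = "free_eval R P (\<lambda>p. p)"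
  have e: "?e \<in> rmod_hom R ?F P" by (rule P.free_eval_hom) auto
  have "p \<in> ?e ` carrier ?F" if p: "p \<in> carrier P" for p
  proof (rule image_eqI)
    let ?d = "\<lambda>s. if s = p then \<one>\<^bsub>R\<^esub> else \<zero>\<^bsub>R\<^esub>"
    show d: "?d \<in> carrier ?F"
      using p by (auto simp: free_rmodule_def intro: finite_subset[of _ "{p}"])
    show "p = ?e ?d"
    proof -
      have supp_d: "{s. ?d s \<noteq> \<zero>\<^bsub>R\<^esub>} \<subseteq> {p}" by auto
      have "?e ?d = (\<Oplus>\<^bsub>P\<^esub>s \<in> {p}. s \<star>\<^bsub>P\<^esub> ?d s)"
        using p supp_d by (intro P.free_eval_superset[OF _ d]) (simp_all add: Pi_def)
      also have "\<dots> = p" using p by (simp add: P.M.finsum_insert)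
      finally show ?thesis by (rule sym)
    qed
  qed
  then have "?e ` carrier ?F = carrier P" using e by (auto simp: rmod_hom_def)
  moreover have "(\<lambda>x. x) \<in> rmod_hom R P P" by (auto simp: rmod_hom_def)
  moreover have "lifts_along R P ?F P" using P Fm Pm by (simp add: projective_rmodule_def)
  ultimately obtain s where s: "s \<in> rmod_hom R P ?F" and es: "\<And>x. x \<in> carrier P \<Longrightarrow> ?e (s x) = x"
    using e unfolding lifts_along_def by metis
  have "\<exists>y. y \<in> carrier M \<and> g y = f p" if "p \<in> carrier P" for p
  proof -
    have "f p \<in> g ` carrier M" unfolding surj using f that by (auto simp: rmod_hom_def)
    then show ?thesis by auto
  qed
  then obtain m where m: "\<And>p. p \<in> carrier P \<Longrightarrow> m p \<in> carrier M \<and> g (m p) = f p"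
    by metis
  let ?k = "free_eval R M m"
  have k: "?k \<in> rmod_hom R ?F M" using m by (intro M.free_eval_hom) auto
  have "(\<lambda>x. ?k (s x)) \<in> rmod_hom R P M" using k s by (auto simp: rmod_hom_def Pi_def)
  moreover have "g (?k (s x)) = f x" if x: "x \<in> carrier P" for x
  proof -
    interpret N: right_module R N by fact
    have sx: "s x \<in> carrier ?F" using s x by (auto simp: rmod_hom_def)
    have "g (?k (s x)) = free_eval R N (\<lambda>p. g (m p)) (s x)"
      using m sx by (intro free_eval_comp[OF M N g]) auto
    also have "\<dots> = free_eval R N (\<lambda>p. f p) (s x)"
      unfolding free_eval_def using m sx f
      by (intro N.M.finsum_cong') (auto simp: free_rmodule_def rmod_hom_def Pi_def subset_iff)
    also have "\<dots> = f (?e (s x))"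
      using sx by (intro free_eval_comp[OF Pm N f, symmetric]) auto
    finally show ?thesis using es x by simp
  qed
  ultimately show "\<exists>h \<in> rmod_hom R P M. \<forall>x \<in> carrier P. g (h x) = f x"
    by (intro bexI[of _ "\<lambda>x. ?k (s x)"]) simp_all
qed

end

theory Submission
  imports Defs
begin

text \<open>
  A finite subset \<open>A\<close> of \<open>I\<close> witnesses (ii) as soon as \<open>A\<close> lies in \<open>I\<close> times the left ideal
  spanned by \<open>A\<close>.  If \<open>\<phi> p\<close> is a dual basis of a projective module, then
  \<open>\<phi> p y = \<Sum>q. \<phi> p q \<otimes> \<phi> q y\<close>, so the coordinates of finitely many elements form such a set.
  Conversely, iterating (ii) gives finite sets \<open>A 0 \<subseteq> A 1 \<subseteq> ...\<close> in \<open>I\<close> such that every element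
  of \<open>A n\<close> is a combination of elements of \<open>A n\<close> with coefficients in \<open>A (n + 1)\<close>.  The left
  ideals spanned by the \<open>A n\<close> yield the sequence unions.  In the direct system of free modules
  on words \<open>w\<close>, with transition map \<open>w \<mapsto> \<Sum>a. (a # w) \<star> a\<close>, these relations split the
  telescope of the system (Whitehead's argument), hence the limit is projective; its trace
  ideal is generated by the letters.
\<close>

section \<open>Left ideals\<close>

text \<open>Two consecutive transition steps send a word \<open>w\<close> of length \<open>n\<close>
  to the sum of all \<open>b # a # w\<close> with multiplier \<open>b\<close> times
  \<open>a\<close>, where \<open>b\<close> runs through the whole of \<open>A (n + 1)\<close>. As
  the coefficient of \<open>a\<close> in the relation for a letter \<open>d\<close> is one of these
  \<open>b\<close>, one step can be undone by a map whose matrix entries are only 0 and 1: it sends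
  \<open>b # a # w\<close> to the sum of those \<open>d # w\<close> for which \<open>b\<close> is
  that coefficient. The tails of the words keep the pieces apart. This map shortens words, so the
  sum of its powers is finite on each basis element and yields an explicit retraction of the
  telescope. The limit is therefore never formed as a quotient: in its place stands the image of an
  idempotent endomorphism of a free module, and the trace ideal is read off from the coordinates of
  that endomorphism. A single sequence of finite sets only reaches a countably generated ideal; a
  general \<open>I\<close> is obtained from the direct sum of such systems, one for each
  element.\<close>

lemma (in abelian_group) additive_subgroup_finsum_closed:
  assumes "additive_subgroup H G" "f \<in> T \<rightarrow> H"
  shows "finsum G f T \<in> H"
proof -
  interpret additive_subgroup H G by fact
  show ?thesis using assms(2)
  proof (induction T rule: infinite_finite_induct)
    case (insert t T)
    then have "f \<in> T \<rightarrow> carrier G" "f t \<in> carrier G" using a_subset by auto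
    then show ?case using insert by (simp add: finsum_insert)
  qed simp_all
qed

text \<open>Closure under negation is automatic, since \<open>\<ominus> a\<close> is
  \<open>\<ominus> \<one>\<close> times \<open>a\<close>.\<close>

lemma left_idealI:
  fixes R (structure)
  assumes "ring R" "J \<subseteq> carrier R" "\<zero> \<in> J"
    and add: "\<And>a b. \<lbrakk>a \<in> J; b \<in> J\<rbrakk> \<Longrightarrow> a \<oplus> b \<in> J"
    and mult: "\<And>a x. \<lbrakk>a \<in> J; x \<in> carrier R\<rbrakk> \<Longrightarrow> x \<otimes> a \<in> J"
  shows "left_ideal J R"
proof -
  interpret ring R by fact
  have neg: "\<ominus> a \<in> J" if "a \<in> J" for a
    using mult[OF that, of "\<ominus> \<one>"] assms(2) that by (auto simp: l_minus)
  show ?thesis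
  proof (intro left_ideal.intro left_ideal_axioms.intro additive_subgroup.intro assms(1) mult)
    show "subgroup J (add_monoid R)"
      using assms(2,3) add neg
      by (intro add.subgroupI) (auto simp flip: a_inv_def)
  qed
qed

lemma ideal_imp_left_ideal: "ideal I R \<Longrightarrow> left_ideal I R"
  by (simp add: ideal_def ideal_axioms_def left_ideal_def left_ideal_axioms_def)

text \<open>The intersection from \<open>fg_left_ideal\<close>. Statements about its elements are
  proved by minimality: the elements with the desired property are shown to form a left ideal
  containing \<open>A\<close>, which avoids linear combinations.\<close>

definition left_span :: "('a, 'c) ring_scheme \<Rightarrow> 'a set \<Rightarrow> 'a set"
  where "left_span R A = \<Inter>{L. left_ideal L R \<and> A \<subseteq> L}"

lemma fg_left_ideal_iff:
  "fg_left_ideal J R \<longleftrightarrow> (\<exists>A \<subseteq> carrier R. finite A \<and> J = left_span R A)"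
  by (simp add: fg_left_ideal_def left_span_def)

context ring
begin

lemma left_ideal_carrier: "left_ideal (carrier R) R"
  by (rule left_idealI) (auto intro: ring_axioms)

lemma left_ideal_left_span:
  assumes "A \<subseteq> carrier R"
  shows "left_ideal (left_span R A) R"
proof -
  have mem: "left_ideal (carrier R) R \<and> A \<subseteq> carrier R" using assms left_ideal_carrier by simp
  have sub: "left_ideal L R \<Longrightarrow> additive_subgroup L R" for L by (simp add: left_ideal_def)
  show ?thesis unfolding left_span_def
    by (rule left_idealI)
      (use mem in \<open>auto intro: ring_axioms additive_subgroup.zero_closed[OF sub]
        additive_subgroup.a_closed[OF sub] left_ideal.l_closed\<close>)
qed

lemma left_span_superset: "A \<subseteq> left_span R A"
  by (auto simp: left_span_def)

lemma left_span_minimal: "\<lbrakk>left_ideal L R; A \<subseteq> L\<rbrakk> \<Longrightarrow> left_span R A \<subseteq> L"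
  by (auto simp: left_span_def)

lemma left_span_mono: "A \<subseteq> B \<Longrightarrow> left_span R A \<subseteq> left_span R B"
  by (auto simp: left_span_def)

lemma left_span_carrier: "A \<subseteq> carrier R \<Longrightarrow> left_span R A \<subseteq> carrier R"
  by (rule left_span_minimal[OF left_ideal_carrier])

section \<open>Products of additive subgroups\<close>

lemma subgroup_prod_additive:
  assumes "A \<subseteq> carrier R" "B \<subseteq> carrier R"
  shows "additive_subgroup (A \<bullet>\<^bsub>R\<^esub> B) R"
  unfolding subgroup_prod_def
  by (rule additive_subgroup.intro, rule add.generate_is_subgroup) (use assms in auto)

lemma subgroup_prod_mem: "\<lbrakk>a \<in> A; b \<in> B\<rbrakk> \<Longrightarrow> a \<otimes> b \<in> A \<bullet>\<^bsub>R\<^esub> B"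
  unfolding subgroup_prod_def by (rule generate.incl) auto

lemma subgroup_prod_mono: "\<lbrakk>A \<subseteq> A'; B \<subseteq> B'\<rbrakk> \<Longrightarrow> A \<bullet>\<^bsub>R\<^esub> B \<subseteq> A' \<bullet>\<^bsub>R\<^esub> B'"
  unfolding subgroup_prod_def by (rule add.mono_generate) auto

lemma generate_minimal:
  assumes "additive_subgroup H R" "X \<subseteq> H"
  shows "generate (add_monoid R) X \<subseteq> H"
  using assms by (intro add.generate_subgroup_incl) (auto simp: additive_subgroup_def)

lemma subgroup_prod_minimal:
  assumes "additive_subgroup H R" "\<And>a b. \<lbrakk>a \<in> A; b \<in> B\<rbrakk> \<Longrightarrow> a \<otimes> b \<in> H"
  shows "A \<bullet>\<^bsub>R\<^esub> B \<subseteq> H"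
  unfolding subgroup_prod_def by (rule generate_minimal) (use assms in auto)

text \<open>Extends properties from the products \<open>a \<otimes> b\<close> to the subgroup they
  generate: multiplication by a fixed element is additive, so it suffices to test
  generators.\<close>

lemma additive_subgroup_vimage:
  assumes "additive_subgroup H R" "f \<in> carrier R \<rightarrow> carrier R"
    and "\<And>x y. \<lbrakk>x \<in> carrier R; y \<in> carrier R\<rbrakk> \<Longrightarrow> f (x \<oplus> y) = f x \<oplus> f y"
  shows "additive_subgroup {x \<in> carrier R. f x \<in> H} R"
proof -
  interpret H: additive_subgroup H R by fact
  have z: "f \<zero> = \<zero>"
    using assms(3)[of \<zero> \<zero>] assms(2) by (auto simp: Pi_def)
  have m: "f (\<ominus> x) = \<ominus> f x" if "x \<in> carrier R" for x
  proof -
    have "f (\<ominus> x) \<oplus> f x = \<zero>" using assms(3)[of "\<ominus> x" x] that z by (simp add: l_neg)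
    then show ?thesis
      using assms(2) that by (intro minus_equality[symmetric]) (auto simp: Pi_def)
  qed
  show ?thesis
  proof (rule additive_subgroup.intro, rule add.subgroupI)
    show "{x \<in> carrier R. f x \<in> H} \<noteq> {}" using z by (auto intro!: exI[of _ \<zero>])
  qed (use assms(3) m in \<open>auto simp flip: a_inv_def\<close>)
qed

lemma subgroup_prod_l_closed:
  assumes A: "left_ideal A R" and B: "B \<subseteq> carrier R"
    and z: "z \<in> A \<bullet>\<^bsub>R\<^esub> B" and r: "r \<in> carrier R"
  shows "r \<otimes> z \<in> A \<bullet>\<^bsub>R\<^esub> B"
proof -
  interpret A: left_ideal A R by fact
  have "A \<bullet>\<^bsub>R\<^esub> B \<subseteq> {z \<in> carrier R. r \<otimes> z \<in> A \<bullet>\<^bsub>R\<^esub> B}"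
  proof (rule subgroup_prod_minimal)
    show "additive_subgroup {z \<in> carrier R. r \<otimes> z \<in> A \<bullet>\<^bsub>R\<^esub> B} R"
      by (rule additive_subgroup_vimage)
        (use r B A.a_subset in \<open>auto simp: r_distr intro: subgroup_prod_additive\<close>)
    fix a b assume "a \<in> A" "b \<in> B"
    then show "a \<otimes> b \<in> {z \<in> carrier R. r \<otimes> z \<in> A \<bullet>\<^bsub>R\<^esub> B}"
      using r B A.a_subset subgroup_prod_mem[of "r \<otimes> a" A b B] A.l_closed
      by (auto simp: m_assoc subset_iff)
  qed
  then show ?thesis using z by blast
qed

lemma left_ideal_subgroup_prod:
  assumes "left_ideal A R" "B \<subseteq> carrier R"
  shows "left_ideal (A \<bullet>\<^bsub>R\<^esub> B) R"
proof -
  interpret A: left_ideal A R by fact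
  show ?thesis
    by (intro left_ideal.intro left_ideal_axioms.intro ring_axioms subgroup_prod_additive
        subgroup_prod_l_closed assms A.a_subset)
qed

lemma subgroup_prod_left_ideal_subset:
  assumes "left_ideal J R" "A \<subseteq> carrier R" "L \<subseteq> J"
  shows "A \<bullet>\<^bsub>R\<^esub> L \<subseteq> J"
proof -
  interpret left_ideal J R by fact
  show ?thesis by (rule subgroup_prod_minimal[OF is_additive_subgroup]) (use assms l_closed in auto)
qed

text \<open>Right multiplication need not preserve a left ideal \<open>B\<close>, but may carry it
  into another one. The left factor may grow at the same time, which serves the passage from
  \<open>J\<close> to \<open>I\<close>.\<close>

lemma subgroup_prod_r_mult:
  assumes "A \<subseteq> carrier R" "B \<subseteq> carrier R" "b \<in> carrier R"
    and "\<And>l. l \<in> B \<Longrightarrow> l \<otimes> b \<in> B'" and "A \<subseteq> A'" "A' \<subseteq> carrier R" "B' \<subseteq> carrier R"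
    and z: "z \<in> A \<bullet>\<^bsub>R\<^esub> B"
  shows "z \<otimes> b \<in> A' \<bullet>\<^bsub>R\<^esub> B'"
proof -
  have "A \<bullet>\<^bsub>R\<^esub> B \<subseteq> {z \<in> carrier R. z \<otimes> b \<in> A' \<bullet>\<^bsub>R\<^esub> B'}"
  proof (rule subgroup_prod_minimal)
    show "additive_subgroup {z \<in> carrier R. z \<otimes> b \<in> A' \<bullet>\<^bsub>R\<^esub> B'} R"
      by (rule additive_subgroup_vimage)
        (use assms in \<open>auto simp: l_distr intro: subgroup_prod_additive\<close>)
    fix x y assume "x \<in> A" "y \<in> B"
    then show "x \<otimes> y \<in> {z \<in> carrier R. z \<otimes> b \<in> A' \<bullet>\<^bsub>R\<^esub> B'}"
      using assms subgroup_prod_mem[of x A' "y \<otimes> b" B'] by (auto simp: m_assoc subset_iff)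
  qed
  then show ?thesis using z by blast
qed

lemma ideal_subgroup_prod_carrier:
  assumes "left_ideal J R"
  shows "ideal (J \<bullet>\<^bsub>R\<^esub> carrier R) R"
proof -
  interpret J: left_ideal J R by fact
  interpret P: left_ideal "J \<bullet>\<^bsub>R\<^esub> carrier R" R
    by (rule left_ideal_subgroup_prod[OF assms]) simp
  show ?thesis
    by (intro ideal.intro ideal_axioms.intro P.is_additive_subgroup ring_axioms P.l_closed
        subgroup_prod_r_mult[of J "carrier R" _ "carrier R" J])
      (auto simp: J.a_subset)
qed

lemma subset_subgroup_prod_carrier:
  assumes "J \<subseteq> carrier R"
  shows "J \<subseteq> J \<bullet>\<^bsub>R\<^esub> carrier R"
proof
  fix x assume "x \<in> J"
  then show "x \<in> J \<bullet>\<^bsub>R\<^esub> carrier R"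
    using subgroup_prod_mem[of x J \<one> "carrier R"] assms by (auto simp: subset_iff)
qed

lemma subgroup_prod_subset_ideal:
  assumes "ideal I R" "J \<subseteq> I" "B \<subseteq> carrier R"
  shows "J \<bullet>\<^bsub>R\<^esub> B \<subseteq> I"
proof -
  interpret ideal I R by fact
  show ?thesis
    by (rule subgroup_prod_minimal[OF is_additive_subgroup]) (use assms I_r_closed in auto)
qed

section \<open>Finite witnesses and the covering condition\<close>

lemma generate_finite_subset:
  assumes "x \<in> generate (add_monoid R) H"
  obtains H' where "finite H'" "H' \<subseteq> H" "x \<in> generate (add_monoid R) H'"
proof -
  have "\<exists>H'. finite H' \<and> H' \<subseteq> H \<and> x \<in> generate (add_monoid R) H'"
    using assms
  proof (induction rule: generate.induct)
    case one
    then show ?case by (intro exI[of _ "{}"]) (use generate.one[of "add_monoid R"] in simp)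
  next
    case (incl h)
    then show ?case by (intro exI[of _ "{h}"]) (auto intro: generate.incl)
  next
    case (inv h)
    then show ?case by (intro exI[of _ "{h}"]) (auto intro: generate.inv)
  next
    case (eng x y)
    then obtain X Y where XY: "finite X" "X \<subseteq> H" "x \<in> generate (add_monoid R) X"
        "finite Y" "Y \<subseteq> H" "y \<in> generate (add_monoid R) Y"
      by blast
    have "x \<in> generate (add_monoid R) (X \<union> Y)" "y \<in> generate (add_monoid R) (X \<union> Y)"
      using XY add.mono_generate[of X "X \<union> Y"] add.mono_generate[of Y "X \<union> Y"] by auto
    then have "x \<oplus> y \<in> generate (add_monoid R) (X \<union> Y)"
      using generate.eng[of x "add_monoid R"] by simp
    then show ?case using XY by (intro exI[of _ "X \<union> Y"]) simp
  qed
  then show ?thesis using that by blast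
qed

lemma subgroup_prod_finite_subsets:
  assumes "finite X" "X \<subseteq> A \<bullet>\<^bsub>R\<^esub> B"
  obtains A' B' where "finite A'" "A' \<subseteq> A" "finite B'" "B' \<subseteq> B" "X \<subseteq> A' \<bullet>\<^bsub>R\<^esub> B'"
proof -
  have "\<exists>A' B'. finite A' \<and> A' \<subseteq> A \<and> finite B' \<and> B' \<subseteq> B \<and> X \<subseteq> A' \<bullet>\<^bsub>R\<^esub> B'"
    using assms
  proof (induction X rule: finite_induct)
    case empty
    then show ?case by (intro exI[of _ "{}"]) simp
  next
    case (insert x X)
    then obtain A1 B1 where 1: "finite A1" "A1 \<subseteq> A" "finite B1" "B1 \<subseteq> B" "X \<subseteq> A1 \<bullet>\<^bsub>R\<^esub> B1"
      by auto
    obtain Z where Z: "finite Z" "Z \<subseteq> {a \<otimes> b | a b. a \<in> A \<and> b \<in> B}"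
        "x \<in> generate (add_monoid R) Z"
      using insert.prems generate_finite_subset unfolding subgroup_prod_def by blast
    have "\<forall>z \<in> Z. \<exists>p. p \<in> A \<times> B \<and> z = fst p \<otimes> snd p" using Z(2) by force
    then obtain p where p: "\<And>z. z \<in> Z \<Longrightarrow> p z \<in> A \<times> B \<and> z = fst (p z) \<otimes> snd (p z)"
      by metis
    define A2 where "A2 = fst ` p ` Z"
    define B2 where "B2 = snd ` p ` Z"
    have "Z \<subseteq> {a \<otimes> b | a b. a \<in> A2 \<and> b \<in> B2}" using p by (fastforce simp: A2_def B2_def)
    then have "x \<in> A2 \<bullet>\<^bsub>R\<^esub> B2"
      using Z(3) add.mono_generate unfolding subgroup_prod_def by blast
    moreover have "finite A2" "finite B2" "A2 \<subseteq> A" "B2 \<subseteq> B"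
      using Z p by (fastforce simp: A2_def B2_def)+
    ultimately show ?case
      using 1 subgroup_prod_mono[of A1 "A1 \<union> A2" B1 "B1 \<union> B2"]
        subgroup_prod_mono[of A2 "A1 \<union> A2" B2 "B1 \<union> B2"]
      by (intro exI[of _ "A1 \<union> A2"] exI[of _ "B1 \<union> B2"]) auto
  qed
  then show ?thesis using that by blast
qed

text \<open>Removes the second left ideal from the condition. Forwards, generators \<open>A\<close>
  of \<open>J1\<close> lie in \<open>J1\<close>, which is the product of
  \<open>J2 \<subseteq> J\<close> and \<open>J1\<close>. Backwards, expressing \<open>A\<close>
  needs only finitely many left factors \<open>Y \<subseteq> J\<close>, and
  \<open>A \<union> Y\<close> spans a suitable \<open>J2\<close>; that the product is contained in
  \<open>J1\<close> holds for any left ideal \<open>J1\<close>.\<close>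

lemma finite_subsets_covered_iff:
  assumes J: "left_ideal J R"
  shows "finite_subsets_covered R J \<longleftrightarrow>
    (\<forall>X. finite X \<and> X \<subseteq> J \<longrightarrow>
      (\<exists>A. finite A \<and> A \<subseteq> J \<and> X \<subseteq> left_span R A \<and> A \<subseteq> J \<bullet>\<^bsub>R\<^esub> left_span R A))"
    (is "_ \<longleftrightarrow> ?rhs")
proof
  interpret J: left_ideal J R by fact
  assume L: "finite_subsets_covered R J"
  show ?rhs
  proof (intro allI impI)
    fix X assume "finite X \<and> X \<subseteq> J"
    with L[unfolded finite_subsets_covered_def, rule_format, of X]
    obtain J1 J2 where J1: "fg_left_ideal J1 R" "J1 \<subseteq> J2" "J2 \<subseteq> J" "X \<subseteq> J1" "J2 \<bullet>\<^bsub>R\<^esub> J1 = J1"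
      by auto
    obtain A where A: "finite A" "A \<subseteq> carrier R" "J1 = left_span R A"
      using J1(1) by (auto simp: fg_left_ideal_iff)
    have "A \<subseteq> J1" using A left_span_superset by auto
    then have "A \<subseteq> J \<bullet>\<^bsub>R\<^esub> left_span R A"
      using J1(5) subgroup_prod_mono[OF J1(3) order_refl[of J1]] A(3) by auto
    moreover have "A \<subseteq> J" using \<open>A \<subseteq> J1\<close> J1(2,3) by (meson subset_trans)
    ultimately show "\<exists>A. finite A \<and> A \<subseteq> J \<and> X \<subseteq> left_span R A \<and>
        A \<subseteq> J \<bullet>\<^bsub>R\<^esub> left_span R A"
      using A J1(4) by (intro exI[of _ A]) simp
  qed
next
  interpret J: left_ideal J R by fact
  assume R: ?rhs
  show "finite_subsets_covered R J"
    unfolding finite_subsets_covered_def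
  proof (intro allI impI)
    fix X assume "finite X \<and> X \<subseteq> J"
    from R[rule_format, OF this]
    obtain A where A: "finite A" "A \<subseteq> J" "X \<subseteq> left_span R A" "A \<subseteq> J \<bullet>\<^bsub>R\<^esub> left_span R A"
      by (elim exE conjE)
    have Ac: "A \<subseteq> carrier R" using A J.a_subset by auto
    obtain Y B' where Y: "finite Y" "Y \<subseteq> J" and "finite B'"
      and B': "B' \<subseteq> left_span R A" "A \<subseteq> Y \<bullet>\<^bsub>R\<^esub> B'"
      by (rule subgroup_prod_finite_subsets[OF A(1,4)])
    define J1 where "J1 = left_span R A"
    define J2 where "J2 = left_span R (A \<union> Y)"
    have AY: "A \<union> Y \<subseteq> carrier R" using Ac Y J.a_subset by auto
    have J1: "left_ideal J1 R" unfolding J1_def using Ac by (rule left_ideal_left_span)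
    have J2: "left_ideal J2 R" unfolding J2_def using AY by (rule left_ideal_left_span)
    have J2c: "J2 \<subseteq> carrier R" unfolding J2_def using AY by (rule left_span_carrier)
    have J1c: "J1 \<subseteq> carrier R" unfolding J1_def using Ac by (rule left_span_carrier)
    have "Y \<subseteq> J2" unfolding J2_def using left_span_superset[of "A \<union> Y"] by auto
    then have "A \<subseteq> J2 \<bullet>\<^bsub>R\<^esub> J1"
      using B' subgroup_prod_mono[of Y J2 B' J1] by (auto simp: J1_def)
    then have "J1 \<subseteq> J2 \<bullet>\<^bsub>R\<^esub> J1"
      using left_span_minimal[OF left_ideal_subgroup_prod[OF J2 J1c]] by (simp add: J1_def)
    moreover have "J2 \<bullet>\<^bsub>R\<^esub> J1 \<subseteq> J1" using subgroup_prod_left_ideal_subset[OF J1 J2c] by simp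
    moreover have "fg_left_ideal J1 R"
      using A(1) Ac unfolding fg_left_ideal_iff J1_def by blast
    moreover have "fg_left_ideal J2 R"
      using A(1) Y(1) AY unfolding fg_left_ideal_iff J2_def by blast
    moreover have "J1 \<subseteq> J2" unfolding J1_def J2_def by (rule left_span_mono) simp
    moreover have "J2 \<subseteq> J" unfolding J2_def using A Y by (intro left_span_minimal[OF J]) simp
    ultimately show "\<exists>J1 J2. fg_left_ideal J1 R \<and> fg_left_ideal J2 R \<and>
        J1 \<subseteq> J2 \<and> J2 \<subseteq> J \<and> X \<subseteq> J1 \<and> J2 \<bullet>\<^bsub>R\<^esub> J1 = J1"
      using A(3) unfolding J1_def[symmetric] by (intro exI[of _ J1] exI[of _ J2]) simp
  qed
qed

lemma left_span_absorb:
  assumes "X \<subseteq> left_span R A" "A \<subseteq> carrier R"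
  shows "left_span R (A \<union> X) = left_span R A"
  using assms left_span_minimal[OF left_ideal_left_span[OF assms(2)], of "A \<union> X"]
    left_span_superset[of A] left_span_mono[of A "A \<union> X"]
  by blast

text \<open>A finite subset of \<open>I\<close> involves finitely many left factors
  \<open>A0\<close> from \<open>J\<close> and right factors \<open>B\<close>. If \<open>A\<close> is
  a witness for \<open>A0\<close> in \<open>J\<close>, the products of \<open>A\<close> with
  \<open>B\<close> form a witness in \<open>I\<close>: right multiplication by
  \<open>b \<in> B\<close> carries the left span of \<open>A\<close> into that of the products,
  hence also carries the relations of \<open>A\<close> to relations of the products.\<close>

lemma finite_subsets_covered_ideal:
  assumes I: "ideal I R" and J: "left_ideal J R" "J \<subseteq> I" "J \<bullet>\<^bsub>R\<^esub> carrier R = I"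
    and cov: "finite_subsets_covered R J"
  shows "finite_subsets_covered R I"
  unfolding finite_subsets_covered_iff[OF ideal_imp_left_ideal[OF I]]
proof (intro allI impI)
  interpret I: ideal I R by fact
  interpret J: left_ideal J R by fact
  fix X assume X: "finite X \<and> X \<subseteq> I"
  then have "finite X" "X \<subseteq> J \<bullet>\<^bsub>R\<^esub> carrier R" using J(3) by auto
  then obtain A0 B where AB: "finite A0" "A0 \<subseteq> J" "finite B" "B \<subseteq> carrier R" "X \<subseteq> A0 \<bullet>\<^bsub>R\<^esub> B"
    by (rule subgroup_prod_finite_subsets)
  obtain A where A: "finite A" "A \<subseteq> J" "A0 \<subseteq> left_span R A" "A \<subseteq> J \<bullet>\<^bsub>R\<^esub> left_span R A"
    using cov[unfolded finite_subsets_covered_iff[OF J(1)], rule_format, OF conjI[OF AB(1,2)]]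
    by (elim exE conjE)
  have Ac: "A \<subseteq> carrier R" using A J.a_subset by auto
  define C where "C = (\<lambda>(a, b). a \<otimes> b) ` (A \<times> B)"
  have "A \<subseteq> I" using A(2) J(2) by (rule subset_trans)
  then have C: "finite C" "C \<subseteq> I"
    using A(1) AB(3,4) I.I_r_closed by (auto simp: C_def subset_iff)
  have Cc: "C \<subseteq> carrier R" using C I.a_subset by auto
  interpret S: left_ideal "left_span R C" R using Cc by (rule left_ideal_left_span)
  have AbC: "l \<otimes> b \<in> left_span R C" if b: "b \<in> B" and l: "l \<in> left_span R A" for l b
  proof -
    have bc: "b \<in> carrier R" using b AB(4) by auto
    have "left_span R A \<subseteq> {l \<in> carrier R. l \<otimes> b \<in> left_span R C}"
    proof (rule left_span_minimal, rule left_idealI)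
      show "A \<subseteq> {l \<in> carrier R. l \<otimes> b \<in> left_span R C}"
        using Ac b left_span_superset[of C] by (auto simp: C_def)
    qed (use bc in \<open>auto simp: l_distr m_assoc intro: ring_axioms S.l_closed\<close>)
    then show ?thesis using l by blast
  qed
  have "A0 \<bullet>\<^bsub>R\<^esub> B \<subseteq> left_span R C"
    using A(3) AbC by (intro subgroup_prod_minimal[OF S.is_additive_subgroup]) auto
  moreover have "a \<otimes> b \<in> I \<bullet>\<^bsub>R\<^esub> left_span R C" if "a \<in> A" "b \<in> B" for a b
    using that A(4) AB(4) J(2) J.a_subset I.a_subset AbC S.a_subset left_span_carrier[OF Ac]
    by (intro subgroup_prod_r_mult[of J "left_span R A"]) auto
  then have "C \<subseteq> I \<bullet>\<^bsub>R\<^esub> left_span R C" by (auto simp: C_def)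
  ultimately show "\<exists>A. finite A \<and> A \<subseteq> I \<and> X \<subseteq> left_span R A \<and> A \<subseteq> I \<bullet>\<^bsub>R\<^esub> left_span R A"
    using C AB(5) by (intro exI[of _ C]) simp
qed

text \<open>
  As \<open>I\<close> is closed under right multiplication, the coefficients of the elements of a
  spanning set can be absorbed into \<open>I\<close>; this is what makes finitely many of them suffice.
\<close>

lemma ideal_prod_span_combination:
  assumes I: "ideal I R" and A: "finite A" "A \<subseteq> carrier R" and z: "z \<in> I \<bullet>\<^bsub>R\<^esub> left_span R A"
  shows "\<exists>c \<in> A \<rightarrow> I. z = (\<Oplus>a \<in> A. c a \<otimes> a)"
proof -
  interpret I: ideal I R by fact
  define D where "D = {\<Oplus>a \<in> A. c a \<otimes> a | c. c \<in> A \<rightarrow> I}"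
  have D: "left_ideal D R"
  proof (rule left_idealI[OF ring_axioms])
    show "D \<subseteq> carrier R"
      using A I.a_subset by (auto simp: D_def subset_iff Pi_def intro!: finsum_closed)
    have "\<zero> = (\<Oplus>a \<in> A. \<zero> \<otimes> a)" using A by (subst add.finprod_one_eqI) auto
    then show "\<zero> \<in> D" unfolding D_def by (intro CollectI exI[of _ "\<lambda>_. \<zero>"]) auto
  next
    fix x y assume "x \<in> D" "y \<in> D"
    then obtain c d where cd: "c \<in> A \<rightarrow> I" "d \<in> A \<rightarrow> I" "x = (\<Oplus>a \<in> A. c a \<otimes> a)" "y = (\<Oplus>a \<in> A. d a \<otimes> a)"
      by (auto simp: D_def)
    have cdc: "c \<in> A \<rightarrow> carrier R" "d \<in> A \<rightarrow> carrier R" using cd I.a_subset by auto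
    have "x \<oplus> y = (\<Oplus>a \<in> A. c a \<otimes> a \<oplus> d a \<otimes> a)"
      unfolding cd using A cdc by (intro finsum_addf[symmetric]) (auto simp: Pi_def subset_iff)
    also have "\<dots> = (\<Oplus>a \<in> A. (c a \<oplus> d a) \<otimes> a)"
      using A cdc by (intro finsum_cong') (auto simp: Pi_def subset_iff l_distr)
    finally show "x \<oplus> y \<in> D"
      using cd unfolding D_def by (intro CollectI exI[of _ "\<lambda>a. c a \<oplus> d a"]) auto
  next
    fix x r assume x: "x \<in> D" and r: "r \<in> carrier R"
    from x obtain c where c: "c \<in> A \<rightarrow> I" "x = (\<Oplus>a \<in> A. c a \<otimes> a)" by (auto simp: D_def)
    have cc: "c \<in> A \<rightarrow> carrier R" using c I.a_subset by auto
    have "r \<otimes> x = (\<Oplus>a \<in> A. r \<otimes> (c a \<otimes> a))"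
      unfolding c using A cc r by (intro finsum_rdistr) (auto simp: Pi_def subset_iff)
    also have "\<dots> = (\<Oplus>a \<in> A. (r \<otimes> c a) \<otimes> a)"
      using A cc r by (intro finsum_cong') (auto simp: Pi_def subset_iff m_assoc)
    finally show "r \<otimes> x \<in> D"
      using c r I.I_l_closed unfolding D_def by (intro CollectI exI[of _ "\<lambda>a. r \<otimes> c a"]) auto
  qed
  interpret D: left_ideal D R by fact
  have single: "i \<otimes> a \<in> D" if "i \<in> I" "a \<in> A" for i a
  proof -
    have "(\<Oplus>x \<in> A. (if a = x then i else \<zero>) \<otimes> x) = (\<Oplus>x \<in> A. if a = x then i \<otimes> x else \<zero>)"
      using A that I.a_subset by (intro finsum_cong') (auto simp: subset_iff)
    also have "\<dots> = i \<otimes> a"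
      using A that I.a_subset by (intro finsum_singleton) (auto simp: subset_iff Pi_def)
    finally show ?thesis
      using that unfolding D_def
      by (intro CollectI exI[of _ "\<lambda>x. if a = x then i else \<zero>"]) auto
  qed
  \<comment> \<open>Testing against all \<open>i\<close> at once makes this set a left ideal:
    \<open>i \<otimes> (x \<otimes> s)\<close> is \<open>(i \<otimes> x) \<otimes> s\<close>, and
    \<open>i \<otimes> x\<close> is again in \<open>I\<close>.\<close>
  have "left_span R A \<subseteq> {s \<in> carrier R. \<forall>i \<in> I. i \<otimes> s \<in> D}"
  proof (rule left_span_minimal, rule left_idealI[OF ring_axioms])
    fix s x assume "s \<in> {s \<in> carrier R. \<forall>i \<in> I. i \<otimes> s \<in> D}" "x \<in> carrier R"
    moreover have "i \<otimes> (x \<otimes> s) \<in> D" if "i \<in> I" for i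
      using calculation that I.I_r_closed[of i x] I.a_subset
      by (auto simp: m_assoc[symmetric] subset_iff)
    ultimately show "x \<otimes> s \<in> {s \<in> carrier R. \<forall>i \<in> I. i \<otimes> s \<in> D}" by simp
  qed (use A(2) I.a_subset single in \<open>auto simp: r_distr subset_iff\<close>)
  then have "I \<bullet>\<^bsub>R\<^esub> left_span R A \<subseteq> D"
    by (intro subgroup_prod_minimal[OF D.is_additive_subgroup]) auto
  then show ?thesis using z by (auto simp: D_def)
qed

text \<open>Since \<open>X\<close> lies in the left span of the witness, adjoining \<open>X\<close>
  to the witness leaves the span unchanged. Thus \<open>X\<close> itself may be part of a finite set
  whose elements are combinations of that same set with coefficients in \<open>I\<close>.\<close>

lemma covered_step:
  assumes I: "ideal I R" and cov: "finite_subsets_covered R I" and X: "finite X" "X \<subseteq> I"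
  obtains A c where "finite A" "X \<subseteq> A" "A \<subseteq> I" "\<And>a. a \<in> A \<Longrightarrow> c a \<in> A \<rightarrow> I"
    "\<And>a. a \<in> A \<Longrightarrow> a = (\<Oplus>b \<in> A. c a b \<otimes> b)"
proof -
  interpret I: ideal I R by fact
  obtain A0 where A0: "finite A0" "A0 \<subseteq> I" "X \<subseteq> left_span R A0" "A0 \<subseteq> I \<bullet>\<^bsub>R\<^esub> left_span R A0"
    using cov[unfolded finite_subsets_covered_iff[OF ideal_imp_left_ideal[OF I]],
        rule_format, OF conjI[OF X]]
    by (elim exE conjE)
  define A where "A = A0 \<union> X"
  have A: "finite A" "X \<subseteq> A" "A \<subseteq> I" "A \<subseteq> carrier R" "A0 \<subseteq> carrier R"
    using A0 X I.a_subset by (auto simp: A_def)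
  have sp: "left_span R A = left_span R A0"
    unfolding A_def using A0(3) A(5) by (rule left_span_absorb)
  have "left_ideal (I \<bullet>\<^bsub>R\<^esub> left_span R A0) R"
    using left_ideal_subgroup_prod[OF ideal_imp_left_ideal[OF I]] left_span_carrier[OF A(5)] by blast
  then have "left_span R A0 \<subseteq> I \<bullet>\<^bsub>R\<^esub> left_span R A0" using A0(4) by (rule left_span_minimal)
  then have "A \<subseteq> I \<bullet>\<^bsub>R\<^esub> left_span R A" using A0 sp by (auto simp: A_def)
  then have "\<forall>a \<in> A. \<exists>c. c \<in> A \<rightarrow> I \<and> a = (\<Oplus>b \<in> A. c b \<otimes> b)"
    using ideal_prod_span_combination[OF I A(1,4)] unfolding Bex_def by (meson subsetD)
  from bchoice[OF this] obtain c
    where c: "\<forall>a \<in> A. c a \<in> A \<rightarrow> I \<and> a = (\<Oplus>b \<in> A. c a b \<otimes> b)"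
    by (elim exE)
  show ?thesis by (rule that[of A c]) (use A c in blast)+
qed

text \<open>Dependent choice over pairs of a finite set and its coefficients. The sequence
  \<open>x\<close> prescribes one element for each stage, which allows a whole countable set to be
  absorbed.\<close>

lemma covered_sequence:
  assumes I: "ideal I R" and cov: "finite_subsets_covered R I" and x: "range x \<subseteq> I"
  obtains A :: "nat \<Rightarrow> 'a set" and c where "\<And>n. finite (A n)" "\<And>n. A n \<subseteq> I"
    "\<And>n. A n \<subseteq> A (Suc n)" "\<And>n. x n \<in> A n"
    "\<And>n a. a \<in> A n \<Longrightarrow> c n a \<in> A n \<rightarrow> A (Suc n)"
    "\<And>n a. a \<in> A n \<Longrightarrow> a = (\<Oplus>b \<in> A n. c n a b \<otimes> b)"
proof -
  define good where "good = (\<lambda>n (A, c). finite A \<and> A \<subseteq> I \<and> x n \<in> A \<and>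
    (\<forall>a \<in> A. c a \<in> A \<rightarrow> I \<and> a = (\<Oplus>b \<in> A. c a b \<otimes> b)))"
  define compat where "compat = (\<lambda>(A, c :: 'a \<Rightarrow> 'a \<Rightarrow> 'a) (A', c' :: 'a \<Rightarrow> 'a \<Rightarrow> 'a).
    A \<subseteq> A' \<and> (\<forall>a \<in> A. c a \<in> A \<rightarrow> A'))"
  have base: "\<exists>p. good 0 p"
  proof -
    obtain A c where "finite A" "{x 0} \<subseteq> A" "A \<subseteq> I" "\<And>a. a \<in> A \<Longrightarrow> c a \<in> A \<rightarrow> I"
      "\<And>a. a \<in> A \<Longrightarrow> a = (\<Oplus>b \<in> A. c a b \<otimes> b)"
      using covered_step[OF I cov, of "{x 0}"] x by blast
    then show ?thesis by (intro exI[of _ "(A, c)"]) (simp add: good_def)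
  qed
  have step: "\<exists>q. good (Suc n) q \<and> compat p q" if "good n p" for n p
  proof -
    obtain A c where p: "p = (A, c)" by (cases p)
    \<comment> \<open>The coefficients of one stage are forced into the next set, where they serve
      both as left factors in the next left ideal and as letters of the next level.\<close>
    define X where "X = {x (Suc n)} \<union> A \<union> (\<lambda>(a, b). c a b) ` (A \<times> A)"
    have "finite X" "X \<subseteq> I"
      using that x by (auto simp: good_def p X_def)
    then obtain A' c' where *: "finite A'" "X \<subseteq> A'" "A' \<subseteq> I" "\<And>a. a \<in> A' \<Longrightarrow> c' a \<in> A' \<rightarrow> I"
      "\<And>a. a \<in> A' \<Longrightarrow> a = (\<Oplus>b \<in> A'. c' a b \<otimes> b)"
      using covered_step[OF I cov, of X] by blast
    then have "good (Suc n) (A', c')" by (simp add: good_def X_def)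
    moreover have "compat p (A', c')" using * by (auto simp: compat_def p X_def)
    ultimately show ?thesis by blast
  qed
  obtain f where f: "\<And>n. good n (f n)" "\<And>n. compat (f n) (f (Suc n))"
    using dependent_nat_choice[of good "\<lambda>_. compat"] base step by blast
  show ?thesis
  proof (rule that[of "\<lambda>n. fst (f n)" "\<lambda>n. snd (f n)"])
    fix n
    show "finite (fst (f n))" "fst (f n) \<subseteq> I" "x n \<in> fst (f n)"
      using f(1)[of n] by (auto simp: good_def split_beta)
    show "fst (f n) \<subseteq> fst (f (Suc n))" using f(2)[of n] by (auto simp: compat_def split_beta)
    fix a assume "a \<in> fst (f n)"
    then show "snd (f n) a \<in> fst (f n) \<rightarrow> fst (f (Suc n))"
        "a = (\<Oplus>b \<in> fst (f n). snd (f n) a b \<otimes> b)"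
      using f(1)[of n] f(2)[of n] by (simp_all add: compat_def good_def split_beta)
  qed
qed

end

section \<open>Unions of sequences of left ideals\<close>

context ring
begin

lemma ideal_incseq_Union:
  assumes K: "\<And>n :: nat. ideal (K n) R" and mono: "\<And>n. K n \<subseteq> K (Suc n)"
  shows "ideal (\<Union>n. K n) R"
proof -
  have sub: "additive_subgroup (K n) R" for n using K by (simp add: ideal_def)
  have mono': "m \<le> n \<Longrightarrow> K m \<subseteq> K n" for m n using lift_Suc_mono_le[of K] mono by blast
  have "left_ideal (\<Union>n. K n) R"
  proof (rule left_idealI[OF ring_axioms])
    show "(\<Union>n. K n) \<subseteq> carrier R" using additive_subgroup.a_subset[OF sub] by auto
    show "\<zero> \<in> (\<Union>n. K n)" using additive_subgroup.zero_closed[OF sub] by auto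
    fix a b assume "a \<in> (\<Union>n. K n)" "b \<in> (\<Union>n. K n)"
    then obtain m n where "a \<in> K m" "b \<in> K n" by auto
    then have "a \<in> K (max m n)" "b \<in> K (max m n)"
      using mono'[of m "max m n"] mono'[of n "max m n"] by auto
    then show "a \<oplus> b \<in> (\<Union>n. K n)" using additive_subgroup.a_closed[OF sub] by blast
  qed (auto intro: ideal.I_l_closed[OF K])
  then interpret U: left_ideal "\<Union>n. K n" R .
  show ?thesis
  proof (intro ideal.intro ideal_axioms.intro U.is_additive_subgroup ring_axioms)
    fix a x assume "a \<in> (\<Union>n. K n)" "x \<in> carrier R"
    then show "x \<otimes> a \<in> (\<Union>n. K n)" "a \<otimes> x \<in> (\<Union>n. K n)"
      using U.l_closed by (auto intro: ideal.I_r_closed[OF K])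
  qed
qed

text \<open>The stages run through an enumeration of \<open>X\<close>. Each
  \<open>a \<in> A n\<close> is a sum of products of a coefficient in \<open>A (Suc n)\<close> and
  an element of \<open>A n\<close>, which gives the nontrivial inclusion of \<open>J n\<close> in
  the product of \<open>J (Suc n)\<close> and \<open>J n\<close>.\<close>

lemma covered_countable_subset:
  assumes I: "ideal I R" and cov: "finite_subsets_covered R I"
    and X: "countable X" "X \<subseteq> I"
  obtains K where "ideal K R" "is_sequence_union R K" "K \<subseteq> I" "X \<subseteq> K"
proof -
  interpret I: ideal I R by fact
  \<comment> \<open>Adding \<open>\<zero>\<close> guards against an empty \<open>X\<close>, which
    has no enumeration by all natural numbers.\<close>
  define x where "x = from_nat_into (insert \<zero> X)"
  have x: "range x = insert \<zero> X" unfolding x_def using X(1) by (intro range_from_nat_into) auto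
  then have "range x \<subseteq> I" using X(2) by auto
  from covered_sequence[OF I cov this] obtain A c
    where A: "\<And>n. finite (A n)" "\<And>n. A n \<subseteq> I" "\<And>n. A n \<subseteq> A (Suc n)" "\<And>n. x n \<in> A n"
      and c: "\<And>n a. a \<in> A n \<Longrightarrow> c n a \<in> A n \<rightarrow> A (Suc n)"
        "\<And>n a. a \<in> A n \<Longrightarrow> a = (\<Oplus>b \<in> A n. c n a b \<otimes> b)"
    by blast
  define J where "J n = left_span R (A n)" for n
  define K where "K = (\<Union>n. J n \<bullet>\<^bsub>R\<^esub> carrier R)"
  have Ac: "A n \<subseteq> carrier R" for n using A(2) I.a_subset by blast
  have J: "left_ideal (J n) R" "fg_left_ideal (J n) R" "J n \<subseteq> carrier R" for n
    unfolding J_def fg_left_ideal_iff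
    using Ac A(1) by (auto intro: left_ideal_left_span left_span_carrier[THEN subsetD])
  have JI: "J n \<subseteq> I" for n
    unfolding J_def by (rule left_span_minimal[OF ideal_imp_left_ideal[OF I] A(2)])
  have J_mono: "J n \<subseteq> J (Suc n)" for n unfolding J_def by (rule left_span_mono[OF A(3)])
  have AJ: "A n \<subseteq> J n" for n unfolding J_def by (rule left_span_superset)
  have "J (Suc n) \<bullet>\<^bsub>R\<^esub> J n = J n" for n
  proof
    show "J (Suc n) \<bullet>\<^bsub>R\<^esub> J n \<subseteq> J n"
      by (rule subgroup_prod_left_ideal_subset[OF J(1,3) order_refl])
    interpret S: left_ideal "J (Suc n) \<bullet>\<^bsub>R\<^esub> J n" R
      by (rule left_ideal_subgroup_prod[OF J(1,3)])
    have "a \<in> J (Suc n) \<bullet>\<^bsub>R\<^esub> J n" if a: "a \<in> A n" for a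
    proof -
      have "(\<lambda>b. c n a b \<otimes> b) \<in> A n \<rightarrow> J (Suc n) \<bullet>\<^bsub>R\<^esub> J n"
        using c(1)[OF a] AJ by (intro funcsetI subgroup_prod_mem) blast+
      then show ?thesis
        using additive_subgroup_finsum_closed[OF S.is_additive_subgroup] c(2)[OF a] by metis
    qed
    then show "J n \<subseteq> J (Suc n) \<bullet>\<^bsub>R\<^esub> J n"
      unfolding J_def[of n] by (intro left_span_minimal) (use S.left_ideal_axioms J_def in auto)
  qed
  then have "is_sequence_union R K"
    unfolding is_sequence_union_def K_def using J(2) J_mono by blast
  moreover have "ideal K R" unfolding K_def
    by (intro ideal_incseq_Union ideal_subgroup_prod_carrier J(1) subgroup_prod_mono J_mono order_refl)
  moreover have "K \<subseteq> I" unfolding K_def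
    using subgroup_prod_subset_ideal[OF I JI order_refl] by blast
  moreover have "x n \<in> K" for n
    using A(4)[of n] AJ[of n] subset_subgroup_prod_carrier[OF J(3)[of n]] by (auto simp: K_def)
  then have "range x \<subseteq> K" by auto
  then have "X \<subseteq> K" unfolding x by simp
  ultimately show ?thesis using that[of K] by simp
qed

text \<open>Finite generating sets of all the \<open>J n\<close> together generate \<open>K\<close>
  as a two-sided ideal. Countable generation is what makes countably many such ideals
  boundable.\<close>

lemma sequence_union_countably_generated:
  assumes "is_sequence_union R K" "ideal K R"
  shows "\<exists>Y. countable Y \<and> Y \<subseteq> K \<and> (\<forall>L. ideal L R \<and> Y \<subseteq> L \<longrightarrow> K \<subseteq> L)"
proof -
  obtain J :: "nat \<Rightarrow> 'a set" where J: "\<And>n. fg_left_ideal (J n) R" "K = (\<Union>n. J n \<bullet>\<^bsub>R\<^esub> carrier R)"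
    using assms(1) unfolding is_sequence_union_def by blast
  have "\<exists>A. A \<subseteq> carrier R \<and> finite A \<and> J n = left_span R A" for n
    using J(1)[of n] by (auto simp: fg_left_ideal_iff)
  then obtain A where A: "\<And>n. A n \<subseteq> carrier R" "\<And>n. finite (A n)" "\<And>n. J n = left_span R (A n)"
    by metis
  show ?thesis
  proof (intro exI[of _ "\<Union>n. A n"] conjI allI impI; (elim conjE)?)
    show "countable (\<Union>n. A n)" using A(2) by (auto intro: countable_finite)
    have "A n \<subseteq> J n \<bullet>\<^bsub>R\<^esub> carrier R" for n
      using left_span_superset[of "A n"] subset_subgroup_prod_carrier[OF left_span_carrier[OF A(1)]]
      unfolding A(3) by (rule subset_trans)
    then show "(\<Union>n. A n) \<subseteq> K" unfolding J(2) by blast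
    fix L assume L: "ideal L R" "(\<Union>n. A n) \<subseteq> L"
    then have "J n \<subseteq> L" for n
      unfolding A(3) by (intro left_span_minimal ideal_imp_left_ideal) blast+
    then show "K \<subseteq> L"
      unfolding J(2) by (intro UN_least subgroup_prod_subset_ideal[OF L(1)]) blast+
  qed
qed

text \<open>The family consists of all sequence unions inside \<open>I\<close>. Generators of the
  members of a countable subfamily form a countable subset of \<open>I\<close>; a sequence union
  containing it is an ideal and so contains every member.\<close>

theorem covered_aleph1_directed_union:
  assumes I: "ideal I R" and cov: "finite_subsets_covered R I"
  shows "aleph1_directed_union {K. ideal K R \<and> is_sequence_union R K \<and> K \<subseteq> I} I"
    (is "aleph1_directed_union ?F I")
  unfolding aleph1_directed_union_def
proof (intro conjI allI impI)
  have "\<exists>K \<in> ?F. x \<in> K" if "x \<in> I" for x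
  proof -
    have "countable {x}" "{x} \<subseteq> I" using that by auto
    then obtain K where "ideal K R" "is_sequence_union R K" "K \<subseteq> I" "{x} \<subseteq> K"
      by (rule covered_countable_subset[OF I cov])
    then show ?thesis by auto
  qed
  then show "I = \<Union>?F" by blast
  fix C assume C: "C \<subseteq> ?F" "countable C"
  have "\<exists>Y. countable Y \<and> Y \<subseteq> K \<and> (\<forall>L. ideal L R \<and> Y \<subseteq> L \<longrightarrow> K \<subseteq> L)" if "K \<in> C" for K
  proof -
    have "is_sequence_union R K" "ideal K R" using that C(1) by auto
    then show ?thesis by (rule sequence_union_countably_generated)
  qed
  then have "\<forall>K \<in> C. \<exists>Y. countable Y \<and> Y \<subseteq> K \<and> (\<forall>L. ideal L R \<and> Y \<subseteq> L \<longrightarrow> K \<subseteq> L)" by blast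
  from bchoice[OF this] obtain Y where Y': "\<forall>K \<in> C. countable (Y K) \<and> Y K \<subseteq> K \<and>
      (\<forall>L. ideal L R \<and> Y K \<subseteq> L \<longrightarrow> K \<subseteq> L)"
    by (elim exE)
  then have Y: "countable (Y K)" "Y K \<subseteq> K" "\<lbrakk>ideal L R; Y K \<subseteq> L\<rbrakk> \<Longrightarrow> K \<subseteq> L" if "K \<in> C" for K L
    using that by auto
  have "countable (\<Union>K \<in> C. Y K)" using C(2) Y(1) by simp
  moreover have "(\<Union>K \<in> C. Y K) \<subseteq> I" using C(1) Y(2) by blast
  ultimately obtain L where L: "ideal L R" "is_sequence_union R L" "L \<subseteq> I" "(\<Union>K \<in> C. Y K) \<subseteq> L"
    by (rule covered_countable_subset[OF I cov])
  have "K \<subseteq> L" if "K \<in> C" for K using Y(3)[OF that L(1)] L(4) that by blast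
  then show "\<exists>L \<in> ?F. \<forall>K \<in> C. K \<subseteq> L" using L by blast
qed

end

section \<open>Homomorphisms of right modules\<close>

lemma finsum_regular_rmodule [simp]: "finsum (regular_rmodule R) = finsum R"
  by (intro ext) (simp add: finsum_def finprod_def regular_rmodule_def)

lemma regular_rmodule_simps [simp]:
  "carrier (regular_rmodule R) = carrier R" "rsmult (regular_rmodule R) = mult R"
  "add (regular_rmodule R) = add R" "zero (regular_rmodule R) = zero R"
  by (simp_all add: regular_rmodule_def)

lemma free_rmodule_simps:
  "rsmult (free_rmodule R S) u r = (\<lambda>s. u s \<otimes>\<^bsub>R\<^esub> r)"
  "add (free_rmodule R S) u v = (\<lambda>s. u s \<oplus>\<^bsub>R\<^esub> v s)"
  "zero (free_rmodule R S) = (\<lambda>s. \<zero>\<^bsub>R\<^esub>)"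
  by (simp_all add: free_rmodule_def)

lemma (in ring) right_module_regular_rmodule: "right_module R (regular_rmodule R)"
proof (intro right_module.intro right_module_axioms.intro ring_axioms)
  show "abelian_group (regular_rmodule R)"
  proof (rule abelian_groupI)
    fix x assume "x \<in> carrier (regular_rmodule R)"
    then show "\<exists>y \<in> carrier (regular_rmodule R).
        y \<oplus>\<^bsub>regular_rmodule R\<^esub> x = \<zero>\<^bsub>regular_rmodule R\<^esub>"
      by (intro bexI[of _ "\<ominus> x"]) (auto simp: l_neg)
  qed (auto simp: a_ac)
qed (auto simp: l_distr r_distr m_assoc)

lemma rmod_hom_closed: "\<lbrakk>f \<in> rmod_hom R M N; x \<in> carrier M\<rbrakk> \<Longrightarrow> f x \<in> carrier N"
  by (auto simp: rmod_hom_def)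

lemma rmod_hom_add:
  "\<lbrakk>f \<in> rmod_hom R M N; x \<in> carrier M; y \<in> carrier M\<rbrakk> \<Longrightarrow> f (x \<oplus>\<^bsub>M\<^esub> y) = f x \<oplus>\<^bsub>N\<^esub> f y"
  by (auto simp: rmod_hom_def)

lemma rmod_hom_rsmult:
  "\<lbrakk>f \<in> rmod_hom R M N; x \<in> carrier M; r \<in> carrier R\<rbrakk> \<Longrightarrow> f (x \<star>\<^bsub>M\<^esub> r) = f x \<star>\<^bsub>N\<^esub> r"
  by (auto simp: rmod_hom_def)

lemma rmod_hom_comp:
  assumes "f \<in> rmod_hom R L M" "g \<in> rmod_hom R M N"
  shows "(\<lambda>x. g (f x)) \<in> rmod_hom R L N"
  using assms by (auto simp: rmod_hom_def Pi_def)

lemma (in right_module) rsmult_a_inv: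
  assumes "x \<in> carrier M" "r \<in> carrier R"
  shows "(\<ominus>\<^bsub>M\<^esub> x) \<star>\<^bsub>M\<^esub> r = \<ominus>\<^bsub>M\<^esub> (x \<star>\<^bsub>M\<^esub> r)"
proof (rule M.minus_equality[symmetric])
  show "(\<ominus>\<^bsub>M\<^esub> x) \<star>\<^bsub>M\<^esub> r \<oplus>\<^bsub>M\<^esub> x \<star>\<^bsub>M\<^esub> r = \<zero>\<^bsub>M\<^esub>"
    using assms rsmult_add[of "\<ominus>\<^bsub>M\<^esub> x" x r] by (simp add: M.l_neg)
qed (use assms in auto)

lemma rmod_hom_a_inv:
  assumes M: "right_module R M" and N: "right_module R N" and f: "f \<in> rmod_hom R M N"
    and x: "x \<in> carrier M"
  shows "f (\<ominus>\<^bsub>M\<^esub> x) = \<ominus>\<^bsub>N\<^esub> f x"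
proof -
  interpret M: right_module R M by fact
  interpret N: right_module R N by fact
  have "f (\<ominus>\<^bsub>M\<^esub> x) \<oplus>\<^bsub>N\<^esub> f x = \<zero>\<^bsub>N\<^esub>"
    using rmod_hom_add[OF f, of "\<ominus>\<^bsub>M\<^esub> x" x] x rmod_hom_zero[OF M N f] by (simp add: M.M.l_neg)
  then show ?thesis
    using rmod_hom_closed[OF f] x by (intro N.M.minus_equality[symmetric]) auto
qed

lemma rmod_hom_plus:
  assumes "right_module R N" "f \<in> rmod_hom R M N" "g \<in> rmod_hom R M N"
  shows "(\<lambda>x. f x \<oplus>\<^bsub>N\<^esub> g x) \<in> rmod_hom R M N"
proof -
  interpret N: right_module R N by fact
  show ?thesis using assms(2,3)
    by (auto simp: rmod_hom_def Pi_def N.M.a_ac N.rsmult_add)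
qed

lemma rmod_hom_minus:
  assumes N: "right_module R N" and f: "f \<in> rmod_hom R M N" and g: "g \<in> rmod_hom R M N"
  shows "(\<lambda>x. f x \<ominus>\<^bsub>N\<^esub> g x) \<in> rmod_hom R M N"
proof -
  interpret N: right_module R N by fact
  have "(\<lambda>x. \<ominus>\<^bsub>N\<^esub> g x) \<in> rmod_hom R M N"
    using g by (auto simp: rmod_hom_def Pi_def N.M.minus_add N.rsmult_a_inv)
  then show ?thesis unfolding a_minus_def by (rule rmod_hom_plus[OF N f])
qed

text \<open>Associativity of row times matrix times column, with the row in the module. It is
  applied below to a matrix of zeros and ones and to the matrix of the coefficients
  \<open>c\<close>.\<close>

lemma (in right_module) finsum_rsmult_assoc:
  assumes "finite J" "finite D" "y \<in> D \<rightarrow> carrier M" "b \<in> J \<rightarrow> carrier R"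
    and "\<And>d j. \<lbrakk>d \<in> D; j \<in> J\<rbrakk> \<Longrightarrow> C d j \<in> carrier R"
  shows "(\<Oplus>\<^bsub>M\<^esub>j \<in> J. (\<Oplus>\<^bsub>M\<^esub>d \<in> D. y d \<star>\<^bsub>M\<^esub> C d j) \<star>\<^bsub>M\<^esub> b j) =
    (\<Oplus>\<^bsub>M\<^esub>d \<in> D. y d \<star>\<^bsub>M\<^esub> (\<Oplus>\<^bsub>R\<^esub>j \<in> J. C d j \<otimes>\<^bsub>R\<^esub> b j))"
  using assms(1,4,5)
proof (induction J rule: finite_induct)
  case empty
  have "(\<Oplus>\<^bsub>M\<^esub>d \<in> D. y d \<star>\<^bsub>M\<^esub> \<zero>\<^bsub>R\<^esub>) = \<zero>\<^bsub>M\<^esub>"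
    using assms(3) by (intro M.add.finprod_one_eqI) (auto simp: Pi_def)
  then show ?case by simp
next
  case (insert j J)
  have y: "y d \<in> carrier M" if "d \<in> D" for d using assms(3) that by auto
  have b: "b i \<in> carrier R" if "i \<in> insert j J" for i using insert.prems(1) that by auto
  have C: "C d i \<in> carrier R" if "d \<in> D" "i \<in> insert j J" for d i using insert.prems(2) that by blast
  define z where "z d = (\<Oplus>\<^bsub>R\<^esub>i \<in> J. C d i \<otimes>\<^bsub>R\<^esub> b i)" for d
  have z: "z d \<in> carrier R" if "d \<in> D" for d
    unfolding z_def using b C that by (intro R.finsum_closed) auto
  have yC: "(\<Oplus>\<^bsub>M\<^esub>d \<in> D. y d \<star>\<^bsub>M\<^esub> C d i) \<in> carrier M" if "i \<in> insert j J" for i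
    using y C that by (intro M.finsum_closed) auto
  have "(\<Oplus>\<^bsub>M\<^esub>i \<in> insert j J. (\<Oplus>\<^bsub>M\<^esub>d \<in> D. y d \<star>\<^bsub>M\<^esub> C d i) \<star>\<^bsub>M\<^esub> b i)
      = (\<Oplus>\<^bsub>M\<^esub>d \<in> D. y d \<star>\<^bsub>M\<^esub> C d j) \<star>\<^bsub>M\<^esub> b j \<oplus>\<^bsub>M\<^esub>
        (\<Oplus>\<^bsub>M\<^esub>i \<in> J. (\<Oplus>\<^bsub>M\<^esub>d \<in> D. y d \<star>\<^bsub>M\<^esub> C d i) \<star>\<^bsub>M\<^esub> b i)"
    using insert.hyps yC b by (intro M.finsum_insert) auto
  also have "(\<Oplus>\<^bsub>M\<^esub>i \<in> J. (\<Oplus>\<^bsub>M\<^esub>d \<in> D. y d \<star>\<^bsub>M\<^esub> C d i) \<star>\<^bsub>M\<^esub> b i) = (\<Oplus>\<^bsub>M\<^esub>d \<in> D. y d \<star>\<^bsub>M\<^esub> z d)"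
    unfolding z_def using b C by (intro insert.IH) auto
  also have "(\<Oplus>\<^bsub>M\<^esub>d \<in> D. y d \<star>\<^bsub>M\<^esub> C d j) \<star>\<^bsub>M\<^esub> b j = (\<Oplus>\<^bsub>M\<^esub>d \<in> D. (y d \<star>\<^bsub>M\<^esub> C d j) \<star>\<^bsub>M\<^esub> b j)"
    using assms(2) y C b by (intro finsum_rsmult) auto
  also have "\<dots> \<oplus>\<^bsub>M\<^esub> (\<Oplus>\<^bsub>M\<^esub>d \<in> D. y d \<star>\<^bsub>M\<^esub> z d)
      = (\<Oplus>\<^bsub>M\<^esub>d \<in> D. (y d \<star>\<^bsub>M\<^esub> C d j) \<star>\<^bsub>M\<^esub> b j \<oplus>\<^bsub>M\<^esub> y d \<star>\<^bsub>M\<^esub> z d)"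
    using y C b z by (intro M.finsum_addf[symmetric]) auto
  also have "\<dots> = (\<Oplus>\<^bsub>M\<^esub>d \<in> D. y d \<star>\<^bsub>M\<^esub> (\<Oplus>\<^bsub>R\<^esub>i \<in> insert j J. C d i \<otimes>\<^bsub>R\<^esub> b i))"
  proof (intro M.finsum_cong' refl)
    fix d assume d: "d \<in> D"
    have "(\<Oplus>\<^bsub>R\<^esub>i \<in> insert j J. C d i \<otimes>\<^bsub>R\<^esub> b i) = C d j \<otimes>\<^bsub>R\<^esub> b j \<oplus>\<^bsub>R\<^esub> z d"
      unfolding z_def using insert.hyps b C d by (intro R.finsum_insert) auto
    then show "(y d \<star>\<^bsub>M\<^esub> C d j) \<star>\<^bsub>M\<^esub> b j \<oplus>\<^bsub>M\<^esub> y d \<star>\<^bsub>M\<^esub> z d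
        = y d \<star>\<^bsub>M\<^esub> (\<Oplus>\<^bsub>R\<^esub>i \<in> insert j J. C d i \<otimes>\<^bsub>R\<^esub> b i)"
      using y[OF d] C[OF d, of j] b[of j] z[OF d] by (simp add: rsmult_add_scalar rsmult_assoc)
  next
    show "(\<lambda>d. y d \<star>\<^bsub>M\<^esub> (\<Oplus>\<^bsub>R\<^esub>i \<in> insert j J. C d i \<otimes>\<^bsub>R\<^esub> b i)) \<in> D \<rightarrow> carrier M"
      using y C b by (intro funcsetI rsmult_closed R.finsum_closed) auto
  qed
  finally show ?case .
qed

section \<open>Free modules\<close>

definition free_unit :: "('a, 'c) ring_scheme \<Rightarrow> 's \<Rightarrow> 's \<Rightarrow> 'a"
  where "free_unit R s = (\<lambda>t. if t = s then \<one>\<^bsub>R\<^esub> else \<zero>\<^bsub>R\<^esub>)"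

context ring
begin

lemma free_unit_carrier: "s \<in> S \<Longrightarrow> free_unit R s \<in> carrier (free_rmodule R S)"
  by (auto simp: free_rmodule_def free_unit_def intro: finite_subset[of _ "{s}"])

lemma free_eval_unit:
  assumes N: "right_module R N" and m: "m \<in> S \<rightarrow> carrier N" and s: "s \<in> S"
  shows "free_eval R N m (free_unit R s) = m s"
proof -
  interpret N: right_module R N by fact
  have "free_eval R N m (free_unit R s) = (\<Oplus>\<^bsub>N\<^esub>t \<in> {s}. m t \<star>\<^bsub>N\<^esub> free_unit R s t)"
    using m s by (intro N.free_eval_superset[OF _ free_unit_carrier[OF s]])
      (auto simp: free_unit_def)
  also have "\<dots> = m s \<star>\<^bsub>N\<^esub> free_unit R s s"
    using m s by (subst N.M.finsum_insert) (auto simp: free_unit_def Pi_def)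
  also have "\<dots> = m s" using m s by (auto simp: free_unit_def Pi_def)
  finally show ?thesis .
qed

lemma free_coordinate_hom: "(\<lambda>u. u t) \<in> rmod_hom R (free_rmodule R S) (regular_rmodule R)"
  by (auto simp: rmod_hom_def) (auto simp: free_rmodule_def)

lemma free_eval_free_unit:
  assumes u: "u \<in> carrier (free_rmodule R S)"
  shows "free_eval R (free_rmodule R S) (free_unit R) u = u"
proof
  fix t
  let ?F = "free_rmodule R S"
  have F: "right_module R ?F" by (rule free_rmodule_right_module[OF ring_axioms])
  have supp: "finite {s. u s \<noteq> \<zero>}" "{s. u s \<noteq> \<zero>} \<subseteq> S" "\<And>s. u s \<in> carrier R"
    using u by (auto simp: free_rmodule_def)
  have "free_eval R ?F (free_unit R) u t = free_eval R (regular_rmodule R) (\<lambda>s. free_unit R s t) u"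
    by (rule free_eval_comp[OF F right_module_regular_rmodule free_coordinate_hom _ u])
      (simp add: free_unit_carrier)
  also have "\<dots> = (\<Oplus>s \<in> {s. u s \<noteq> \<zero>}. if t = s then u s else \<zero>)"
    unfolding free_eval_def using supp by (auto simp: free_unit_def intro!: finsum_cong')
  also have "\<dots> = u t"
  proof (cases "u t = \<zero>")
    case True
    then show ?thesis by (auto intro: add.finprod_one_eqI)
  next
    case False
    then show ?thesis using supp by (intro finsum_singleton) auto
  qed
  finally show "free_eval R ?F (free_unit R) u t = u t" .
qed

lemma free_hom_eq_eval:
  assumes N: "right_module R N" and f: "f \<in> rmod_hom R (free_rmodule R S) N"
    and u: "u \<in> carrier (free_rmodule R S)"
  shows "f u = (\<Oplus>\<^bsub>N\<^esub>s \<in> {s. u s \<noteq> \<zero>}. f (free_unit R s) \<star>\<^bsub>N\<^esub> u s)"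
proof -
  have "free_unit R \<in> S \<rightarrow> carrier (free_rmodule R S)" by (simp add: free_unit_carrier)
  from free_eval_comp[OF free_rmodule_right_module[OF ring_axioms] N f this u] show ?thesis
    unfolding free_eval_free_unit[OF u] by (simp only: free_eval_def)
qed

lemma free_hom_eqI:
  assumes N: "right_module R N" and f: "f \<in> rmod_hom R (free_rmodule R S) N"
    and g: "g \<in> rmod_hom R (free_rmodule R S) N"
    and eq: "\<And>s. s \<in> S \<Longrightarrow> f (free_unit R s) = g (free_unit R s)"
    and u: "u \<in> carrier (free_rmodule R S)"
  shows "f u = g u"
proof -
  interpret N: right_module R N by fact
  have "{s. u s \<noteq> \<zero>} \<subseteq> S" "\<And>s. u s \<in> carrier R" using u by (auto simp: free_rmodule_def)
  then show ?thesis
    unfolding free_hom_eq_eval[OF N f u] free_hom_eq_eval[OF N g u]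
    using rmod_hom_closed[OF g free_unit_carrier] eq
    by (intro N.M.finsum_cong') (auto simp: subset_iff)
qed

lemma left_ideal_finsum_mult_closed:
  assumes "left_ideal L R" "f \<in> T \<rightarrow> carrier R" "g \<in> T \<rightarrow> L"
  shows "(\<Oplus>t \<in> T. f t \<otimes> g t) \<in> L"
proof -
  interpret left_ideal L R by fact
  show ?thesis
    using assms(2,3)
    by (intro additive_subgroup_finsum_closed[OF is_additive_subgroup]) (auto simp: Pi_def l_closed)
qed

lemma ideal_finsum_mult_closed:
  assumes "ideal I R" "f \<in> T \<rightarrow> I" "g \<in> T \<rightarrow> carrier R"
  shows "(\<Oplus>t \<in> T. f t \<otimes> g t) \<in> I"
proof -
  interpret ideal I R by fact
  show ?thesis
    using assms(2,3)
    by (intro additive_subgroup_finsum_closed[OF is_additive_subgroup]) (auto simp: Pi_def I_r_closed)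
qed

lemma free_eval_coordinate_in_ideal:
  assumes I: "ideal I R" and m: "m \<in> S \<rightarrow> carrier (free_rmodule R S)"
    and mI: "\<And>s t. s \<in> S \<Longrightarrow> m s t \<in> I" and u: "u \<in> carrier (free_rmodule R S)"
  shows "free_eval R (free_rmodule R S) m u t \<in> I"
proof -
  have "{s. u s \<noteq> \<zero>} \<subseteq> S" "\<And>s. u s \<in> carrier R" using u by (auto simp: free_rmodule_def)
  then have "free_eval R (regular_rmodule R) (\<lambda>s. m s t) u \<in> I"
    unfolding free_eval_def using mI by (auto intro!: ideal_finsum_mult_closed[OF I])
  then show ?thesis
    using free_eval_comp[OF free_rmodule_right_module[OF ring_axioms] right_module_regular_rmodule
        free_coordinate_hom m u, of t] by simp
qed

section \<open>Trace ideals of projective modules\<close>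

text \<open>The functionals are the coordinates of a section of the canonical map from the free
  module on the elements of \<open>P\<close>, so the basis element belonging to
  \<open>\<phi> p\<close> is \<open>p\<close> itself.\<close>

lemma projective_dual_basis:
  assumes P: "projective_rmodule R P"
  obtains \<phi> where "\<And>p. \<phi> p \<in> rmod_hom R P (regular_rmodule R)"
    "\<And>x. x \<in> carrier P \<Longrightarrow> finite {p. \<phi> p x \<noteq> \<zero>} \<and> {p. \<phi> p x \<noteq> \<zero>} \<subseteq> carrier P"
    "\<And>x. x \<in> carrier P \<Longrightarrow> x = (\<Oplus>\<^bsub>P\<^esub>p \<in> {p. \<phi> p x \<noteq> \<zero>}. p \<star>\<^bsub>P\<^esub> \<phi> p x)"
proof -
  have Pm: "right_module R P" using P by (simp add: projective_rmodule_def)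
  interpret P: right_module R P by fact
  let ?F = "free_rmodule R (carrier P)"
  have F: "right_module R ?F" by (rule free_rmodule_right_module[OF ring_axioms])
  let ?e = "free_eval R P (\<lambda>p. p)"
  have e: "?e \<in> rmod_hom R ?F P" by (rule P.free_eval_hom) auto
  have "p \<in> ?e ` carrier ?F" if "p \<in> carrier P" for p
    using free_eval_unit[OF Pm, of "\<lambda>p. p" "carrier P" p] free_unit_carrier[OF that] that
    by (intro image_eqI[of _ _ "free_unit R p"]) auto
  then have "?e ` carrier ?F = carrier P" using rmod_hom_closed[OF e] by auto
  moreover have "(\<lambda>x. x) \<in> rmod_hom R P P" by (auto simp: rmod_hom_def)
  moreover have "lifts_along R P ?F P" by (rule projective_rmodule_lifts[OF P F Pm])
  ultimately obtain s where s: "s \<in> rmod_hom R P ?F" and es: "\<And>x. x \<in> carrier P \<Longrightarrow> ?e (s x) = x"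
    using e unfolding lifts_along_def by metis
  show ?thesis
  proof (rule that[of "\<lambda>p x. s x p"])
    show "(\<lambda>x. s x p) \<in> rmod_hom R P (regular_rmodule R)" for p
      using rmod_hom_comp[OF s free_coordinate_hom] .
    fix x assume x: "x \<in> carrier P"
    show "finite {p. s x p \<noteq> \<zero>} \<and> {p. s x p \<noteq> \<zero>} \<subseteq> carrier P"
      using rmod_hom_closed[OF s x] by (auto simp: free_rmodule_def)
    show "x = (\<Oplus>\<^bsub>P\<^esub>p \<in> {p. s x p \<noteq> \<zero>}. p \<star>\<^bsub>P\<^esub> s x p)"
      using es[OF x] by (simp add: free_eval_def)
  qed
qed

theorem projective_trace_covered:
  assumes P: "projective_rmodule R P" and I: "ideal I R" and tr: "I = trace_ideal R P"
  shows "finite_subsets_covered R I"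
  unfolding finite_subsets_covered_iff[OF ideal_imp_left_ideal[OF I]]
proof (intro allI impI)
  have Pm: "right_module R P" using P by (simp add: projective_rmodule_def)
  interpret P: right_module R P by fact
  interpret I: ideal I R by fact
  obtain \<phi> where \<phi>: "\<And>p. \<phi> p \<in> rmod_hom R P (regular_rmodule R)"
    and supp: "\<And>x. x \<in> carrier P \<Longrightarrow> finite {p. \<phi> p x \<noteq> \<zero>} \<and> {p. \<phi> p x \<noteq> \<zero>} \<subseteq> carrier P"
    and dual: "\<And>x. x \<in> carrier P \<Longrightarrow> x = (\<Oplus>\<^bsub>P\<^esub>p \<in> {p. \<phi> p x \<noteq> \<zero>}. p \<star>\<^bsub>P\<^esub> \<phi> p x)"
    using projective_dual_basis[OF P] by blast
  have \<phi>c: "\<phi> p x \<in> carrier R" if "x \<in> carrier P" for p x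
    using rmod_hom_closed[OF \<phi> that] by simp
  have expand: "f x = (\<Oplus>p \<in> {p. \<phi> p x \<noteq> \<zero>}. f p \<otimes> \<phi> p x)"
    if f: "f \<in> rmod_hom R P (regular_rmodule R)" and x: "x \<in> carrier P" for f x
  proof -
    have T: "finite {p. \<phi> p x \<noteq> \<zero>}" "{p. \<phi> p x \<noteq> \<zero>} \<subseteq> carrier P" using supp[OF x] by auto
    have "f x = f (\<Oplus>\<^bsub>P\<^esub>p \<in> {p. \<phi> p x \<noteq> \<zero>}. p \<star>\<^bsub>P\<^esub> \<phi> p x)" using dual[OF x] by simp
    also have "\<dots> = (\<Oplus>p \<in> {p. \<phi> p x \<noteq> \<zero>}. f (p \<star>\<^bsub>P\<^esub> \<phi> p x))"
      using T(2) \<phi>c[OF x]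
      by (subst rmod_hom_finsum[OF Pm right_module_regular_rmodule f T(1)]) auto
    also have "\<dots> = (\<Oplus>p \<in> {p. \<phi> p x \<noteq> \<zero>}. f p \<otimes> \<phi> p x)"
      using T(2) \<phi>c[OF x] rmod_hom_rsmult[OF f] rmod_hom_closed[OF f]
      by (intro finsum_cong') (auto simp: subset_iff)
    finally show ?thesis .
  qed
  have homI: "f x \<in> I" if "f \<in> rmod_hom R P (regular_rmodule R)" "x \<in> carrier P" for f x
    unfolding tr trace_ideal_def using that by (intro generate.incl) auto
  define \<Phi> where "\<Phi> Y = (\<Union>y \<in> Y. (\<lambda>p. \<phi> p y) ` {p. \<phi> p y \<noteq> \<zero>})" for Y
  have \<Phi>c: "\<Phi> Y \<subseteq> carrier R" if "Y \<subseteq> carrier P" for Y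
    using that \<phi>c by (auto simp: \<Phi>_def)
  \<comment> \<open>As \<open>\<Phi>\<close> is monotone, \<open>D\<close> is a directed union of
    left ideals. The trace ideal is generated additively by values \<open>f x\<close>, and
    \<open>expand\<close> puts each of these into the left span of
    \<open>\<Phi> {x}\<close>.\<close>
  define D where "D = {x \<in> carrier R. \<exists>Y \<subseteq> carrier P. finite Y \<and> x \<in> left_span R (\<Phi> Y)}"
  have D: "left_ideal D R"
  proof (rule left_idealI[OF ring_axioms])
    have "\<zero> \<in> left_span R (\<Phi> {})"
      using left_ideal_left_span[of "\<Phi> {}"]
      by (simp add: \<Phi>_def left_ideal_def additive_subgroup.zero_closed)
    then show "\<zero> \<in> D" unfolding D_def by blast
  next
    fix a b assume "a \<in> D" "b \<in> D"
    then obtain Y Z where YZ: "a \<in> carrier R" "b \<in> carrier R" "Y \<subseteq> carrier P" "finite Y"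
        "a \<in> left_span R (\<Phi> Y)" "Z \<subseteq> carrier P" "finite Z" "b \<in> left_span R (\<Phi> Z)"
      by (auto simp: D_def)
    then have YZ': "Y \<union> Z \<subseteq> carrier P" by auto
    interpret S: left_ideal "left_span R (\<Phi> (Y \<union> Z))" R
      by (rule left_ideal_left_span[OF \<Phi>c[OF YZ']])
    have "\<Phi> Y \<subseteq> \<Phi> (Y \<union> Z)" "\<Phi> Z \<subseteq> \<Phi> (Y \<union> Z)" by (auto simp: \<Phi>_def)
    then have "a \<oplus> b \<in> left_span R (\<Phi> (Y \<union> Z))" using YZ left_span_mono by blast
    then show "a \<oplus> b \<in> D" unfolding D_def using YZ YZ' by blast
  next
    fix a r assume "a \<in> D" "r \<in> carrier R"
    then obtain Y where Y: "a \<in> carrier R" "Y \<subseteq> carrier P" "finite Y" "a \<in> left_span R (\<Phi> Y)"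
      by (auto simp: D_def)
    interpret S: left_ideal "left_span R (\<Phi> Y)" R
      by (rule left_ideal_left_span[OF \<Phi>c[OF Y(2)]])
    show "r \<otimes> a \<in> D"
      using Y \<open>r \<in> carrier R\<close> S.l_closed[OF Y(4), of r] by (auto simp: D_def)
  qed (auto simp: D_def)
  have "f x \<in> D" if f: "f \<in> rmod_hom R P (regular_rmodule R)" and x: "x \<in> carrier P" for f x
  proof -
    have "f x \<in> left_span R (\<Phi> {x})"
      unfolding expand[OF f x]
    proof (rule left_ideal_finsum_mult_closed)
      show "left_ideal (left_span R (\<Phi> {x})) R" using x by (intro left_ideal_left_span \<Phi>c) simp
      show "f \<in> {p. \<phi> p x \<noteq> \<zero>} \<rightarrow> carrier R" using supp[OF x] rmod_hom_closed[OF f] by auto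
      show "(\<lambda>p. \<phi> p x) \<in> {p. \<phi> p x \<noteq> \<zero>} \<rightarrow> left_span R (\<Phi> {x})"
        using left_span_superset[of "\<Phi> {x}"] by (auto simp: \<Phi>_def)
    qed
    then show ?thesis
      using x rmod_hom_closed[OF f x] unfolding D_def by (auto intro!: exI[of _ "{x}"])
  qed
  then have ID: "I \<subseteq> D"
    unfolding tr trace_ideal_def using D
    by (intro generate_minimal) (auto simp: left_ideal_def)
  fix X assume X: "finite X \<and> X \<subseteq> I"
  then have "\<forall>x \<in> X. \<exists>Y. Y \<subseteq> carrier P \<and> finite Y \<and> x \<in> left_span R (\<Phi> Y)"
    using ID by (auto simp: D_def)
  from bchoice[OF this] obtain Y
    where Y: "\<And>x. x \<in> X \<Longrightarrow> Y x \<subseteq> carrier P \<and> finite (Y x) \<and> x \<in> left_span R (\<Phi> (Y x))"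
    by auto
  define Z where "Z = (\<Union>x \<in> X. Y x)"
  have Z: "finite Z" "Z \<subseteq> carrier P" using X Y by (auto simp: Z_def)
  have "finite (\<Phi> Z)" unfolding \<Phi>_def using Z supp by (intro finite_UN_I finite_imageI) auto
  moreover have "\<Phi> Z \<subseteq> I" using Z homI[OF \<phi>] by (auto simp: \<Phi>_def)
  moreover have "X \<subseteq> left_span R (\<Phi> Z)"
  proof
    fix x assume x: "x \<in> X"
    then have "\<Phi> (Y x) \<subseteq> \<Phi> Z" by (auto simp: \<Phi>_def Z_def)
    then show "x \<in> left_span R (\<Phi> Z)" using Y[OF x] left_span_mono by blast
  qed
  \<comment> \<open>In the expansion of \<open>\<phi> p y\<close>, the left factors
    \<open>\<phi> p q\<close> are values of a functional on \<open>P\<close> and so lie in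
    \<open>I\<close>, although \<open>q\<close> need not belong to \<open>Z\<close>.\<close>
  moreover have "\<phi> p y \<in> I \<bullet>\<^bsub>R\<^esub> left_span R (\<Phi> Z)" if y: "y \<in> Z" for p y
  proof -
    have yP: "y \<in> carrier P" using y Z by auto
    have "additive_subgroup (I \<bullet>\<^bsub>R\<^esub> left_span R (\<Phi> Z)) R"
      using I.a_subset left_span_carrier[OF \<Phi>c[OF Z(2)]] by (rule subgroup_prod_additive)
    then show ?thesis
    proof (subst expand[OF \<phi> yP], rule additive_subgroup_finsum_closed, intro funcsetI subgroup_prod_mem)
      fix q assume q: "q \<in> {q. \<phi> q y \<noteq> \<zero>}"
      show "\<phi> p q \<in> I" using homI[OF \<phi>] supp[OF yP] q by blast
      show "\<phi> q y \<in> left_span R (\<Phi> Z)"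
        using left_span_superset[of "\<Phi> Z"] q y by (auto simp: \<Phi>_def)
    qed
  qed
  then have "\<Phi> Z \<subseteq> I \<bullet>\<^bsub>R\<^esub> left_span R (\<Phi> Z)" by (auto simp: \<Phi>_def)
  ultimately show "\<exists>A. finite A \<and> A \<subseteq> I \<and> X \<subseteq> left_span R A \<and> A \<subseteq> I \<bullet>\<^bsub>R\<^esub> left_span R A"
    by (intro exI[of _ "\<Phi> Z"]) simp
qed

end

text \<open>For idempotent \<open>E\<close>, the direct summand split off by \<open>E\<close>. Kept
  as a subset of \<open>M\<close>, it lives on the same type as the free module.\<close>

definition rmodule_image :: "('m \<Rightarrow> 'm) \<Rightarrow> ('a, 'm) rmodule \<Rightarrow> ('a, 'm) rmodule"
  where "rmodule_image E M = M\<lparr>carrier := E ` carrier M\<rparr>"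

lemma rmodule_image_simps [simp]:
  "carrier (rmodule_image E M) = E ` carrier M" "add (rmodule_image E M) = add M"
  "zero (rmodule_image E M) = zero M" "rsmult (rmodule_image E M) = rsmult M"
  by (simp_all add: rmodule_image_def)

context ring
begin

lemma right_module_rmodule_image:
  assumes "right_module R F" and E: "E \<in> rmod_hom R F F"
  shows "right_module R (rmodule_image E F)"
proof -
  interpret F: right_module R F by fact
  note Fm = F.right_module_axioms
  show ?thesis
  proof (intro right_module.intro right_module_axioms.intro ring_axioms)
    show "abelian_group (rmodule_image E F)"
    proof (rule abelian_groupI)
      fix x y assume "x \<in> carrier (rmodule_image E F)" "y \<in> carrier (rmodule_image E F)"
      then obtain u v where "u \<in> carrier F" "v \<in> carrier F" "x = E u" "y = E v" by auto
      then show "x \<oplus>\<^bsub>rmodule_image E F\<^esub> y \<in> carrier (rmodule_image E F)"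
        using rmod_hom_add[OF E, of u v] F.M.a_closed[of u v]
        by (intro image_eqI[of _ E "u \<oplus>\<^bsub>F\<^esub> v"] | simp)+
    next
      show "\<zero>\<^bsub>rmodule_image E F\<^esub> \<in> carrier (rmodule_image E F)"
        using rmod_hom_zero[OF Fm Fm E] F.M.zero_closed
        by (intro image_eqI[of _ E "\<zero>\<^bsub>F\<^esub>"] | simp)+
    next
      fix x assume "x \<in> carrier (rmodule_image E F)"
      then obtain u where u: "u \<in> carrier F" "x = E u" by auto
      have "E (\<ominus>\<^bsub>F\<^esub> u) \<oplus>\<^bsub>F\<^esub> x = \<zero>\<^bsub>F\<^esub>"
        using rmod_hom_a_inv[OF Fm Fm E u(1)] rmod_hom_closed[OF E u(1)] u(2)
        by (simp add: F.M.l_neg)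
      then show "\<exists>y \<in> carrier (rmodule_image E F). y \<oplus>\<^bsub>rmodule_image E F\<^esub> x = \<zero>\<^bsub>rmodule_image E F\<^esub>"
        using u(1) by (intro bexI[of _ "E (\<ominus>\<^bsub>F\<^esub> u)"]) simp_all
    qed (auto simp: rmod_hom_closed[OF E] F.M.a_ac)
  next
    fix x r assume "x \<in> carrier (rmodule_image E F)" and r: "r \<in> carrier R"
    then obtain u where u: "u \<in> carrier F" "x = E u" by auto
    show "x \<star>\<^bsub>rmodule_image E F\<^esub> r \<in> carrier (rmodule_image E F)"
      using rmod_hom_rsmult[OF E u(1) r] F.rsmult_closed[OF u(1) r] u(2)
      by (intro image_eqI[of _ E "u \<star>\<^bsub>F\<^esub> r"] | simp)+
  qed (auto simp: rmod_hom_closed[OF E] F.rsmult_add F.rsmult_add_scalar F.rsmult_assoc)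
qed

text \<open>A homomorphism \<open>f\<close> on the summand extends to \<open>f \<circ> E\<close> on
  the free module, where it is lifted by choosing preimages for the basis. Restricting the lift back
  works because \<open>E\<close> is the identity on its image.\<close>

lemma projective_rmodule_image:
  fixes E :: "('s \<Rightarrow> 'a) \<Rightarrow> 's \<Rightarrow> 'a"
  assumes F: "F = free_rmodule R S" and E: "E \<in> rmod_hom R F F"
    and idem: "\<And>u. u \<in> carrier F \<Longrightarrow> E (E u) = E u"
  shows "projective_rmodule R (rmodule_image E F)"
proof -
  let ?P = "rmodule_image E F"
  have Fm: "right_module R F" unfolding F by (rule free_rmodule_right_module[OF ring_axioms])
  have E': "E \<in> rmod_hom R F ?P" using E by (auto simp: rmod_hom_def)
  have sub: "x \<in> carrier F \<and> E x = x" if "x \<in> carrier ?P" for x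
    using that idem rmod_hom_closed[OF E] by auto
  show ?thesis
    unfolding projective_rmodule_def lifts_along_def
  proof (intro conjI right_module_rmodule_image[OF Fm E] allI impI ballI)
    fix M :: "('a, ('s \<Rightarrow> 'a) \<Rightarrow> 'a) rmodule" and N :: "('a, 's \<Rightarrow> 'a) rmodule" and g f
    assume M: "right_module R M" and N: "right_module R N" and g: "g \<in> rmod_hom R M N"
      and f: "f \<in> rmod_hom R ?P N" and surj: "g ` carrier M = carrier N"
    interpret M: right_module R M by fact
    have fE: "(\<lambda>u. f (E u)) \<in> rmod_hom R (free_rmodule R S) N"
      using rmod_hom_comp[OF E' f] unfolding F .
    have "\<exists>y. y \<in> carrier M \<and> g y = f (E (free_unit R s))" if "s \<in> S" for s
      using rmod_hom_closed[OF fE free_unit_carrier[OF that]] unfolding surj[symmetric] by force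
    then obtain m where m: "\<And>s. s \<in> S \<Longrightarrow> m s \<in> carrier M \<and> g (m s) = f (E (free_unit R s))"
      by metis
    have mS: "m \<in> S \<rightarrow> carrier M" using m by auto
    have k: "free_eval R M m \<in> rmod_hom R (free_rmodule R S) M" by (rule M.free_eval_hom[OF mS])
    have gk: "g (free_eval R M m u) = f (E u)" if "u \<in> carrier F" for u
    proof (rule free_hom_eqI[OF N rmod_hom_comp[OF k g] fE _ that[unfolded F]])
      fix s assume "s \<in> S"
      then show "g (free_eval R M m (free_unit R s)) = f (E (free_unit R s))"
        using free_eval_unit[OF M mS] m by simp
    qed
    have "free_eval R M m \<in> rmod_hom R ?P M"
      using k sub unfolding F[symmetric] rmod_hom_def Pi_def rmodule_image_simps(2,4) by blast
    moreover have "\<forall>x \<in> carrier ?P. g (free_eval R M m x) = f x" using gk sub by metis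
    ultimately show "\<exists>h \<in> rmod_hom R ?P M. \<forall>x \<in> carrier ?P. g (h x) = f x" by blast
  qed
qed

text \<open>An element \<open>x = E x\<close> of the summand has coordinates in \<open>I\<close>,
  and a functional sends it to a left combination of them, hence into \<open>I\<close>. Conversely
  the coordinate functions are functionals, and by \<open>IE\<close> they reach all of
  \<open>I\<close>.\<close>

lemma trace_rmodule_image:
  fixes E :: "('s \<Rightarrow> 'a) \<Rightarrow> 's \<Rightarrow> 'a"
  assumes F: "F = free_rmodule R S" and E: "E \<in> rmod_hom R F F"
    and idem: "\<And>u. u \<in> carrier F \<Longrightarrow> E (E u) = E u"
    and I: "ideal I R" and EI: "\<And>u s. u \<in> carrier F \<Longrightarrow> E u s \<in> I"
    and IE: "\<And>x. x \<in> I \<Longrightarrow> \<exists>u \<in> carrier F. \<exists>s. x = E u s"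
  shows "trace_ideal R (rmodule_image E F) = I"
proof
  interpret I: ideal I R by fact
  let ?P = "rmodule_image E F"
  have E': "E \<in> rmod_hom R F ?P" using E by (auto simp: rmod_hom_def)
  have "f x \<in> I" if f: "f \<in> rmod_hom R ?P (regular_rmodule R)" and "x \<in> carrier ?P" for f x
  proof -
    obtain u where u: "u \<in> carrier F" "x = E u" using \<open>x \<in> carrier ?P\<close> by auto
    have x: "x \<in> carrier (free_rmodule R S)" "E x = x"
      using u idem rmod_hom_closed[OF E] by (auto simp flip: F)
    have supp: "{s. x s \<noteq> \<zero>} \<subseteq> S" using x(1) by (auto simp: free_rmodule_def)
    have fE: "(\<lambda>u. f (E u)) \<in> rmod_hom R (free_rmodule R S) (regular_rmodule R)"
      using rmod_hom_comp[OF E' f] unfolding F .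
    have "f (E x) = (\<Oplus>s \<in> {s. x s \<noteq> \<zero>}. f (E (free_unit R s)) \<otimes> x s)"
      using free_hom_eq_eval[OF right_module_regular_rmodule fE x(1)] by simp
    also have "\<dots> \<in> I"
      using EI[OF u(1)] u(2) rmod_hom_closed[OF fE free_unit_carrier] supp
      by (intro left_ideal_finsum_mult_closed[OF ideal_imp_left_ideal[OF I]]) auto
    finally show ?thesis using x(2) by simp
  qed
  then show "trace_ideal R ?P \<subseteq> I"
    unfolding trace_ideal_def by (intro generate_minimal I.is_additive_subgroup) auto
  have "x \<in> trace_ideal R ?P" if "x \<in> I" for x
  proof -
    obtain u s where us: "u \<in> carrier F" "x = E u s" using IE[OF \<open>x \<in> I\<close>] by blast
    have "(\<lambda>u. u s) \<in> rmod_hom R ?P (regular_rmodule R)"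
      using free_coordinate_hom[of s S] rmod_hom_closed[OF E]
      unfolding F[symmetric] rmod_hom_def rmodule_image_simps Pi_def by blast
    then show ?thesis
      unfolding trace_ideal_def using us by (intro generate.incl) (auto intro!: bexI)
  qed
  then show "I \<subseteq> trace_ideal R ?P" by blast
qed

text \<open>
  If \<open>M\<close> shifts along a direct system, \<open>\<lambda>u. u - M u\<close> embeds the direct sum of its terms into
  itself with the direct limit as cokernel.  By \<open>HM\<close>, \<open>\<rho>\<close> is a retraction of this embedding,
  and \<open>E u = u - (\<rho> u - M (\<rho> u))\<close> projects onto a copy of the limit.  The defining form of
  \<open>E\<close> shows that its coordinates lie wherever those of \<open>M\<close> and \<open>H\<close> do.
\<close>

lemma telescope_idempotent:
  fixes F
  assumes Fm: "right_module R F" and M: "M \<in> rmod_hom R F F" and H: "H \<in> rmod_hom R F F"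
    and HM: "\<And>u. u \<in> carrier F \<Longrightarrow> H (M u) = H u \<oplus>\<^bsub>F\<^esub> M (M u)"
  defines "\<rho> \<equiv> \<lambda>u. u \<ominus>\<^bsub>F\<^esub> (H u \<ominus>\<^bsub>F\<^esub> M u)"
  defines "E \<equiv> \<lambda>u. (H u \<ominus>\<^bsub>F\<^esub> M u) \<oplus>\<^bsub>F\<^esub> M (\<rho> u)"
  shows "\<rho> \<in> rmod_hom R F F" "E \<in> rmod_hom R F F" "\<And>u. u \<in> carrier F \<Longrightarrow> E (E u) = E u"
proof -
  interpret F: right_module R F by fact
  have id: "(\<lambda>u. u) \<in> rmod_hom R F F" by (auto simp: rmod_hom_def)
  show \<rho>: "\<rho> \<in> rmod_hom R F F"
    unfolding \<rho>_def by (intro rmod_hom_minus[OF Fm] id M H)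
  show E: "E \<in> rmod_hom R F F"
    unfolding E_def
    by (intro rmod_hom_plus[OF Fm] rmod_hom_minus[OF Fm] M H rmod_hom_comp[OF \<rho> M])
  note cl = rmod_hom_closed[OF M] rmod_hom_closed[OF H] rmod_hom_closed[OF \<rho>] rmod_hom_closed[OF E]
  have hom_minus: "f (x \<ominus>\<^bsub>F\<^esub> y) = f x \<ominus>\<^bsub>F\<^esub> f y"
    if "f \<in> rmod_hom R F F" "x \<in> carrier F" "y \<in> carrier F" for f x y
    using rmod_hom_add[OF that(1,2), of "\<ominus>\<^bsub>F\<^esub> y"] rmod_hom_a_inv[OF Fm Fm that(1,3)] that
    by (simp add: a_minus_def)
  have ET: "E u = u \<ominus>\<^bsub>F\<^esub> (\<rho> u \<ominus>\<^bsub>F\<^esub> M (\<rho> u))" if u: "u \<in> carrier F" for u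
  proof -
    have "u \<ominus>\<^bsub>F\<^esub> (\<rho> u \<ominus>\<^bsub>F\<^esub> m) = (H u \<ominus>\<^bsub>F\<^esub> M u) \<oplus>\<^bsub>F\<^esub> m" if "m \<in> carrier F" for m
      using u that cl(1,2)[of u]
      by (simp add: \<rho>_def a_minus_def F.M.minus_add F.M.a_assoc F.M.r_neg2)
    then show ?thesis using u cl by (simp add: E_def)
  qed
  have \<rho>T: "\<rho> (u \<ominus>\<^bsub>F\<^esub> M u) = u" if u: "u \<in> carrier F" for u
  proof -
    have "\<rho> (u \<ominus>\<^bsub>F\<^esub> M u) = \<rho> u \<ominus>\<^bsub>F\<^esub> \<rho> (M u)" using hom_minus[OF \<rho> u] u cl by simp
    also have "\<rho> (M u) = M u \<ominus>\<^bsub>F\<^esub> H u"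
      using HM[OF u] u cl
      by (simp add: \<rho>_def a_minus_def F.M.a_assoc F.M.r_neg)
    also have "\<rho> u \<ominus>\<^bsub>F\<^esub> (M u \<ominus>\<^bsub>F\<^esub> H u) = u"
      using u cl
      by (simp add: \<rho>_def a_minus_def F.M.minus_add F.M.a_assoc F.M.r_neg1 F.M.r_neg2 F.M.l_neg)
    finally show ?thesis .
  qed
  \<comment> \<open>As \<open>\<rho>\<close> is a left inverse of \<open>1 - M\<close>, it
    annihilates \<open>E u\<close>; by \<open>ET\<close>, a second application of \<open>E\<close>
    then subtracts zero.\<close>
  fix u assume u: "u \<in> carrier F"
  have "\<rho> (E u) = \<rho> u \<ominus>\<^bsub>F\<^esub> \<rho> (\<rho> u \<ominus>\<^bsub>F\<^esub> M (\<rho> u))"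
    unfolding ET[OF u] using hom_minus[OF \<rho> u] u cl by simp
  also have "\<dots> = \<zero>\<^bsub>F\<^esub>" using \<rho>T cl(3)[OF u] by (simp add: a_minus_def F.M.r_neg)
  finally have z: "\<rho> (E u) = \<zero>\<^bsub>F\<^esub>" .
  have "M \<zero>\<^bsub>F\<^esub> = \<zero>\<^bsub>F\<^esub>" by (rule rmod_hom_zero[OF Fm Fm M])
  then show "E (E u) = E u"
    using ET[OF cl(4)[OF u]] z cl(4)[OF u] by (simp add: a_minus_def)
qed

end

section \<open>A projective module with prescribed trace ideal\<close>

text \<open>
  For each \<open>x\<close>, the direct limit of the free modules on the words of length \<open>n\<close> with letters
  from \<open>A x 0, ..., A x (n - 1)\<close>, where a word \<open>w\<close> is sent to \<open>\<Sum>a. (a # w) \<star> a\<close>.  Words are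
  encoded by natural numbers.
\<close>

locale covering_tree = ideal I R for I and R (structure) +
  fixes A :: "'x \<Rightarrow> nat \<Rightarrow> 'a set" and c :: "'x \<Rightarrow> nat \<Rightarrow> 'a \<Rightarrow> 'a \<Rightarrow> 'a"
  assumes finite_A: "finite (A x n)" and A_subset: "A x n \<subseteq> I"
    and c_mem: "\<lbrakk>a \<in> A x n; b \<in> A x n\<rbrakk> \<Longrightarrow> c x n a b \<in> A x (Suc n)"
    and c_sum: "a \<in> A x n \<Longrightarrow> (\<Oplus>b \<in> A x n. c x n a b \<otimes> b) = a"
begin

text \<open>Every letter may stand at every position, so the basis goes beyond the words described
  above. The identities below hold at all of these words: they involve only the length of a word and
  letters of the matching level put in front.\<close>

definition words :: "'x \<Rightarrow> 'a list set"
  where "words x = lists (\<Union>n. A x n)"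

definition node :: "'x \<Rightarrow> 'a list \<Rightarrow> 'x \<times> nat"
  where "node x w = (x, to_nat_on (words x) w)"

text \<open>Every number is decoded, so the free module can be taken on all pairs. A number that
  encodes nothing still stands for some word, and \<open>shift\<close> and \<open>lift\<close> treat
  it like that word.\<close>

definition word :: "'x \<times> nat \<Rightarrow> 'a list"
  where "word s = from_nat_into (words (fst s)) (snd s)"

abbreviation F :: "('a, 'x \<times> nat \<Rightarrow> 'a) rmodule"
  where "F \<equiv> free_rmodule R UNIV"

abbreviation unit :: "'x \<Rightarrow> 'a list \<Rightarrow> 'x \<times> nat \<Rightarrow> 'a"
  where "unit x w \<equiv> free_unit R (node x w)"

text \<open>
  With \<open>N (b # a # w)\<close> the sum of the words \<open>d # w\<close> such that \<open>c d a = b\<close>, the relations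
  \<open>c_sum\<close> say \<open>N \<circ> shift \<circ> shift = shift\<close>, and \<open>branch x w a\<close> is \<open>\<Sum>j. N ^ j (a # w)\<close>.
\<close>

primrec branch :: "'x \<Rightarrow> 'a list \<Rightarrow> 'a \<Rightarrow> 'x \<times> nat \<Rightarrow> 'a" where
  "branch x [] b = unit x [b]"
| "branch x (a # w) b = unit x (b # a # w) \<oplus>\<^bsub>F\<^esub>
    (\<Oplus>\<^bsub>F\<^esub>d \<in> A x (length w). branch x w d \<star>\<^bsub>F\<^esub> (if c x (length w) d a = b then \<one> else \<zero>))"

text \<open>The common form of \<open>shift\<close> and \<open>lift\<close> on a basis element: one
  vector per letter \<open>a\<close>, multiplied by \<open>a\<close>.\<close>

definition combine :: "('x \<Rightarrow> 'a list \<Rightarrow> 'a \<Rightarrow> 'x \<times> nat \<Rightarrow> 'a) \<Rightarrow> 'x \<times> nat \<Rightarrow> 'x \<times> nat \<Rightarrow> 'a"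
  where "combine f s = (\<Oplus>\<^bsub>F\<^esub>a \<in> A (fst s) (length (word s)). f (fst s) (word s) a \<star>\<^bsub>F\<^esub> a)"

definition shift :: "('x \<times> nat \<Rightarrow> 'a) \<Rightarrow> 'x \<times> nat \<Rightarrow> 'a"
  where "shift = free_eval R F (combine (\<lambda>x w a. unit x (a # w)))"

definition lift :: "('x \<times> nat \<Rightarrow> 'a) \<Rightarrow> 'x \<times> nat \<Rightarrow> 'a"
  where "lift = free_eval R F (combine branch)"

section \<open>The endomorphisms \<open>shift\<close> and \<open>lift\<close>\<close>

lemma right_module_F: "right_module R F"
  by (rule free_rmodule_right_module[OF ring_axioms])

sublocale F: right_module R F
  by (rule right_module_F)

lemma A_carrier: "a \<in> A x n \<Longrightarrow> a \<in> carrier R"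
  using A_subset[of x n] a_subset by auto

lemma countable_words: "countable (words x)"
  unfolding words_def using finite_A by (intro countable_lists countable_UN) (auto intro: countable_finite)

lemma word_in_words: "word s \<in> words (fst s)"
  unfolding word_def by (rule from_nat_into) (auto simp: words_def)

lemma word_node [simp]: "w \<in> words x \<Longrightarrow> word (node x w) = w"
  by (simp add: word_def node_def countable_words)

lemma fst_node [simp]: "fst (node x w) = x"
  by (simp add: node_def)

lemma Cons_in_words: "\<lbrakk>a \<in> A x n; w \<in> words x\<rbrakk> \<Longrightarrow> a # w \<in> words x"
  by (auto simp: words_def)

lemma unit_closed [simp]: "free_unit R s \<in> carrier F"
  by (simp add: free_unit_carrier)

lemma branch_closed [simp]: "branch x w a \<in> carrier F"
  by (induction w arbitrary: a) (auto intro!: F.M.a_closed F.M.finsum_closed)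

lemma combine_closed:
  assumes "\<And>x w a. f x w a \<in> carrier F"
  shows "combine f s \<in> carrier F"
  unfolding combine_def using assms A_carrier by (intro F.M.finsum_closed) auto

lemma shift_hom: "shift \<in> rmod_hom R F F"
  unfolding shift_def by (rule F.free_eval_hom) (simp add: combine_closed)

lemma lift_hom: "lift \<in> rmod_hom R F F"
  unfolding lift_def by (rule F.free_eval_hom) (simp add: combine_closed)

lemma shift_unit: "shift (free_unit R s) = combine (\<lambda>x w a. unit x (a # w)) s"
  unfolding shift_def by (rule free_eval_unit[OF right_module_F]) (auto simp: combine_closed)

lemma lift_unit: "lift (free_unit R s) = combine branch s"
  unfolding lift_def by (rule free_eval_unit[OF right_module_F]) (auto simp: combine_closed)

text \<open>Each summand ends in a factor \<open>a \<in> I\<close>, and \<open>I\<close> absorbs the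
  coordinates standing to its left.\<close>

lemma combine_in_ideal:
  assumes f: "\<And>x w a. f x w a \<in> carrier F"
  shows "combine f s t \<in> I"
proof -
  let ?T = "A (fst s) (length (word s))"
  have "combine f s t = (\<Oplus>a \<in> ?T. (f (fst s) (word s) a \<star>\<^bsub>F\<^esub> a) t)"
    unfolding combine_def
    using rmod_hom_finsum[OF right_module_F right_module_regular_rmodule free_coordinate_hom finite_A]
      f A_carrier by (simp add: Pi_def)
  also have "\<dots> = (\<Oplus>a \<in> ?T. f (fst s) (word s) a t \<otimes> a)" by (simp add: free_rmodule_simps)
  also have "\<dots> \<in> I"
    using rmod_hom_closed[OF free_coordinate_hom f] A_subset[THEN subsetD]
    by (intro left_ideal_finsum_mult_closed ideal_imp_left_ideal is_ideal) auto
  finally show ?thesis .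
qed

lemma shift_in_ideal: "u \<in> carrier F \<Longrightarrow> shift u t \<in> I"
  unfolding shift_def
  by (rule free_eval_coordinate_in_ideal[OF is_ideal])
    (auto intro: combine_in_ideal combine_closed)

lemma lift_in_ideal: "u \<in> carrier F \<Longrightarrow> lift u t \<in> I"
  unfolding lift_def
  by (rule free_eval_coordinate_in_ideal[OF is_ideal])
    (auto intro: combine_in_ideal combine_closed)

lemma hom_combine:
  assumes g: "g \<in> rmod_hom R F F" and f: "\<And>x w a. f x w a \<in> carrier F"
  shows "g (combine f s) =
    (\<Oplus>\<^bsub>F\<^esub>a \<in> A (fst s) (length (word s)). g (f (fst s) (word s) a) \<star>\<^bsub>F\<^esub> a)"
proof -
  have "g (combine f s) = (\<Oplus>\<^bsub>F\<^esub>a \<in> A (fst s) (length (word s)). g (f (fst s) (word s) a \<star>\<^bsub>F\<^esub> a))"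
    unfolding combine_def using f A_carrier
    by (intro rmod_hom_finsum[OF right_module_F right_module_F g finite_A]) auto
  also have "\<dots> = (\<Oplus>\<^bsub>F\<^esub>a \<in> A (fst s) (length (word s)). g (f (fst s) (word s) a) \<star>\<^bsub>F\<^esub> a)"
    using rmod_hom_rsmult[OF g f] rmod_hom_closed[OF g f] A_carrier
    by (intro F.M.finsum_cong') auto
  finally show ?thesis .
qed

text \<open>The first summand of \<open>branch\<close> produces \<open>shift\<close>. In the rest,
  for each \<open>d\<close> the only letter \<open>b\<close> that survives is
  \<open>c x (length w) d a\<close>; by \<open>c_mem\<close> it does occur among the letters of the
  next level.\<close>

lemma lift_unit_Cons:
  assumes w: "w \<in> words x" and a: "a \<in> A x (length w)"
  shows "lift (unit x (a # w)) = shift (unit x (a # w)) \<oplus>\<^bsub>F\<^esub>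
    (\<Oplus>\<^bsub>F\<^esub>d \<in> A x (length w). branch x w d \<star>\<^bsub>F\<^esub> c x (length w) d a)"
proof -
  let ?n = "length w"
  let ?C = "\<lambda>d b. if c x ?n d a = b then \<one> else \<zero>"
  let ?S = "\<lambda>b. \<Oplus>\<^bsub>F\<^esub>d \<in> A x ?n. branch x w d \<star>\<^bsub>F\<^esub> ?C d b"
  have aw: "a # w \<in> words x" using a w by (rule Cons_in_words)
  have S: "?S b \<in> carrier F" for b by (intro F.M.finsum_closed) auto
  have "lift (unit x (a # w)) =
      (\<Oplus>\<^bsub>F\<^esub>b \<in> A x (Suc ?n). (unit x (b # a # w) \<oplus>\<^bsub>F\<^esub> ?S b) \<star>\<^bsub>F\<^esub> b)"
    using aw by (simp add: lift_unit combine_def)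
  also have "\<dots> = (\<Oplus>\<^bsub>F\<^esub>b \<in> A x (Suc ?n). unit x (b # a # w) \<star>\<^bsub>F\<^esub> b \<oplus>\<^bsub>F\<^esub> ?S b \<star>\<^bsub>F\<^esub> b)"
    using S A_carrier by (intro F.M.finsum_cong') (auto simp: F.rsmult_add)
  also have "\<dots> = (\<Oplus>\<^bsub>F\<^esub>b \<in> A x (Suc ?n). unit x (b # a # w) \<star>\<^bsub>F\<^esub> b) \<oplus>\<^bsub>F\<^esub>
      (\<Oplus>\<^bsub>F\<^esub>b \<in> A x (Suc ?n). ?S b \<star>\<^bsub>F\<^esub> b)"
    using S A_carrier by (intro F.M.finsum_addf) auto
  also have "(\<Oplus>\<^bsub>F\<^esub>b \<in> A x (Suc ?n). unit x (b # a # w) \<star>\<^bsub>F\<^esub> b) = shift (unit x (a # w))"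
    using aw by (simp add: shift_unit combine_def)
  also have "(\<Oplus>\<^bsub>F\<^esub>b \<in> A x (Suc ?n). ?S b \<star>\<^bsub>F\<^esub> b) =
      (\<Oplus>\<^bsub>F\<^esub>d \<in> A x ?n. branch x w d \<star>\<^bsub>F\<^esub> (\<Oplus>b \<in> A x (Suc ?n). ?C d b \<otimes> b))"
    using A_carrier by (intro F.finsum_rsmult_assoc finite_A) auto
  also have "\<dots> = (\<Oplus>\<^bsub>F\<^esub>d \<in> A x ?n. branch x w d \<star>\<^bsub>F\<^esub> c x ?n d a)"
  proof (intro F.M.finsum_cong' refl)
    fix d assume d: "d \<in> A x ?n"
    have "(\<Oplus>b \<in> A x (Suc ?n). ?C d b \<otimes> b) = (\<Oplus>b \<in> A x (Suc ?n). if c x ?n d a = b then b else \<zero>)"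
      using A_carrier by (intro finsum_cong') auto
    also have "\<dots> = c x ?n d a"
      using A_carrier by (intro finsum_singleton c_mem d a finite_A) auto
    finally show "branch x w d \<star>\<^bsub>F\<^esub> (\<Oplus>b \<in> A x (Suc ?n). ?C d b \<otimes> b) = branch x w d \<star>\<^bsub>F\<^esub> c x ?n d a"
      by simp
  qed (use A_carrier[OF c_mem] a in auto)
  finally show ?thesis .
qed

text \<open>With \<open>N\<close> as above, \<open>lift\<close> is the sum of all
  \<open>N ^ j \<circ> shift\<close>. In \<open>lift \<circ> shift\<close>, the term for
  \<open>j = 0\<close> is \<open>shift \<circ> shift\<close>, and
  \<open>N \<circ> shift \<circ> shift = shift\<close> turns the remaining terms into
  \<open>lift\<close>. This is the hypothesis \<open>HM\<close> of the telescope.\<close>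

lemma lift_shift:
  assumes "u \<in> carrier F"
  shows "lift (shift u) = lift u \<oplus>\<^bsub>F\<^esub> shift (shift u)"
proof (rule free_hom_eqI[OF right_module_F _ _ _ assms])
  show "(\<lambda>u. lift (shift u)) \<in> rmod_hom R F F" by (rule rmod_hom_comp[OF shift_hom lift_hom])
  show "(\<lambda>u. lift u \<oplus>\<^bsub>F\<^esub> shift (shift u)) \<in> rmod_hom R F F"
    by (rule rmod_hom_plus[OF right_module_F lift_hom rmod_hom_comp[OF shift_hom shift_hom]])
  fix s :: "'x \<times> nat"
  define x where "x = fst s"
  define w where "w = word s"
  let ?n = "length w"
  have w: "w \<in> words x" unfolding w_def x_def by (rule word_in_words)
  have cc: "c x ?n d a \<in> carrier R" if "d \<in> A x ?n" "a \<in> A x ?n" for d a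
    using A_carrier[OF c_mem] that by blast
  let ?S = "\<lambda>a. \<Oplus>\<^bsub>F\<^esub>d \<in> A x ?n. branch x w d \<star>\<^bsub>F\<^esub> c x ?n d a"
  have S: "?S a \<in> carrier F" if "a \<in> A x ?n" for a
    using cc that by (intro F.M.finsum_closed) auto
  note sh = rmod_hom_closed[OF shift_hom unit_closed]
  have "lift (shift (free_unit R s)) = (\<Oplus>\<^bsub>F\<^esub>a \<in> A x ?n. lift (unit x (a # w)) \<star>\<^bsub>F\<^esub> a)"
    unfolding shift_unit x_def w_def by (rule hom_combine[OF lift_hom]) simp
  also have "\<dots> = (\<Oplus>\<^bsub>F\<^esub>a \<in> A x ?n. shift (unit x (a # w)) \<star>\<^bsub>F\<^esub> a \<oplus>\<^bsub>F\<^esub> ?S a \<star>\<^bsub>F\<^esub> a)"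
    using S sh A_carrier by (intro F.M.finsum_cong') (auto simp: lift_unit_Cons[OF w] F.rsmult_add)
  also have "\<dots> = (\<Oplus>\<^bsub>F\<^esub>a \<in> A x ?n. shift (unit x (a # w)) \<star>\<^bsub>F\<^esub> a) \<oplus>\<^bsub>F\<^esub>
      (\<Oplus>\<^bsub>F\<^esub>a \<in> A x ?n. ?S a \<star>\<^bsub>F\<^esub> a)"
    using S sh A_carrier by (intro F.M.finsum_addf) auto
  also have "(\<Oplus>\<^bsub>F\<^esub>a \<in> A x ?n. shift (unit x (a # w)) \<star>\<^bsub>F\<^esub> a) = shift (shift (free_unit R s))"
    unfolding shift_unit[of s] x_def w_def by (rule hom_combine[OF shift_hom, symmetric]) simp
  also have "(\<Oplus>\<^bsub>F\<^esub>a \<in> A x ?n. ?S a \<star>\<^bsub>F\<^esub> a) =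
      (\<Oplus>\<^bsub>F\<^esub>d \<in> A x ?n. branch x w d \<star>\<^bsub>F\<^esub> (\<Oplus>a \<in> A x ?n. c x ?n d a \<otimes> a))"
    using A_carrier cc by (intro F.finsum_rsmult_assoc finite_A) auto
  \<comment> \<open>The relations enter here: each inner sum collapses to the letter
    \<open>d\<close>, leaving the value of \<open>lift\<close> at \<open>s\<close>.\<close>
  also have "\<dots> = (\<Oplus>\<^bsub>F\<^esub>d \<in> A x ?n. branch x w d \<star>\<^bsub>F\<^esub> d)"
    using A_carrier by (intro F.M.finsum_cong') (auto simp: c_sum)
  also have "\<dots> = lift (free_unit R s)"
    by (simp add: lift_unit combine_def x_def w_def)
  also have "shift (shift (free_unit R s)) \<oplus>\<^bsub>F\<^esub> lift (free_unit R s) =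
      lift (free_unit R s) \<oplus>\<^bsub>F\<^esub> shift (shift (free_unit R s))"
    by (intro F.M.a_comm rmod_hom_closed[OF shift_hom] rmod_hom_closed[OF lift_hom] unit_closed)
  finally show "lift (shift (free_unit R s)) = lift (free_unit R s) \<oplus>\<^bsub>F\<^esub> shift (shift (free_unit R s))" .
qed

theorem exists_projective:
  assumes roots: "\<And>a. a \<in> I \<Longrightarrow> \<exists>x. a \<in> A x 0"
  shows "\<exists>P :: ('a, 'x \<times> nat \<Rightarrow> 'a) rmodule. projective_rmodule R P \<and> trace_ideal R P = I"
proof -
  define \<rho> where "\<rho> u = u \<ominus>\<^bsub>F\<^esub> (lift u \<ominus>\<^bsub>F\<^esub> shift u)" for u
  define E where "E u = (lift u \<ominus>\<^bsub>F\<^esub> shift u) \<oplus>\<^bsub>F\<^esub> shift (\<rho> u)" for u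
  note tel = telescope_idempotent[OF right_module_F shift_hom lift_hom lift_shift,
      folded \<rho>_def, folded E_def]
  have \<rho>: "\<rho> \<in> rmod_hom R F F" and E: "E \<in> rmod_hom R F F"
    and idem: "\<And>u. u \<in> carrier F \<Longrightarrow> E (E u) = E u"
    using tel by auto
  have EI: "E u t \<in> I" if u: "u \<in> carrier F" for u t
  proof -
    note cl = rmod_hom_closed[OF lift_hom u] rmod_hom_closed[OF shift_hom u]
    \<comment> \<open>Negation in \<open>F\<close> is known only through the group law, so its
      coordinates are recovered from those of the sum.\<close>
    have "(\<ominus>\<^bsub>F\<^esub> shift u \<oplus>\<^bsub>F\<^esub> shift u) t = \<zero>"
      using cl(2) by (simp add: F.M.l_neg) (simp add: free_rmodule_simps)
    then have "(\<ominus>\<^bsub>F\<^esub> shift u) t = \<ominus> (shift u t)"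
      using rmod_hom_closed[OF free_coordinate_hom, of _ UNIV t] cl(2)
      by (intro minus_equality[symmetric]) (simp_all add: free_rmodule_simps)
    then have "E u t = (lift u t \<oplus> \<ominus> (shift u t)) \<oplus> shift (\<rho> u) t"
      by (simp add: E_def a_minus_def free_rmodule_simps)
    then show ?thesis
      using lift_in_ideal[OF u] shift_in_ideal[OF u] shift_in_ideal[OF rmod_hom_closed[OF \<rho> u]] by simp
  qed
  have IE: "\<exists>u \<in> carrier F. \<exists>t. a = E u t" if a: "a \<in> I" for a
  proof -
    obtain x where x: "a \<in> A x 0" using roots[OF a] by blast
    have nil: "[] \<in> words x" by (simp add: words_def)
    \<comment> \<open>At the empty word \<open>branch\<close> has no correction terms. Hence
      \<open>\<rho>\<close> fixes the root and \<open>E\<close> acts on it as \<open>shift\<close>,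
      whose coordinates there are the letters of level 0.\<close>
    have "lift (unit x []) = shift (unit x [])"
      using nil by (simp add: lift_unit shift_unit combine_def)
    then have "\<rho> (unit x []) = unit x []" "E (unit x []) = shift (unit x [])"
      using rmod_hom_closed[OF shift_hom unit_closed]
      by (simp_all add: \<rho>_def E_def a_minus_def F.M.r_neg F.M.minus_equality[of "\<zero>\<^bsub>F\<^esub>" "\<zero>\<^bsub>F\<^esub>"])
    moreover have "shift (unit x []) (node x [a]) = a"
    proof -
      have eq: "node x [a] = node x [b] \<longleftrightarrow> a = b" if "b \<in> A x 0" for b
        using word_node[OF Cons_in_words[OF x nil]] word_node[OF Cons_in_words[OF that nil]]
        by (metis list.inject)
      have "shift (unit x []) (node x [a]) = (\<Oplus>b \<in> A x 0. (unit x [b] \<star>\<^bsub>F\<^esub> b) (node x [a]))"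
        using nil rmod_hom_finsum[OF right_module_F right_module_regular_rmodule free_coordinate_hom finite_A]
          A_carrier by (simp add: shift_unit combine_def Pi_def)
      also have "\<dots> = (\<Oplus>b \<in> A x 0. if a = b then b else \<zero>)"
        using A_carrier by (intro finsum_cong') (auto simp: free_rmodule_simps free_unit_def eq)
      also have "\<dots> = a" using A_carrier by (intro finsum_singleton x finite_A) auto
      finally show ?thesis .
    qed
    ultimately show ?thesis by (intro bexI[of _ "unit x []"] exI[of _ "node x [a]"]) auto
  qed
  show ?thesis
    using projective_rmodule_image[OF refl E idem]
      trace_rmodule_image[OF refl E idem is_ideal EI IE]
    by (intro exI[of _ "rmodule_image E F"] conjI) simp_all
qed

end

text \<open>There is one tree for each \<open>x \<in> I\<close>, with \<open>x\<close> among its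
  letters of level 0. Indexing the trees by ring elements and encoding words by numbers gives a
  basis indexed by \<open>'a \<times> nat\<close>.\<close>

theorem (in ring) covered_imp_projective_trace:
  assumes I: "ideal I R" and cov: "finite_subsets_covered R I"
  shows "\<exists>P :: ('a, 'a \<times> nat \<Rightarrow> 'a) rmodule. projective_rmodule R P \<and> I = trace_ideal R P"
proof -
  let ?Q = "\<lambda>x A c. (\<forall>n :: nat. finite (A n) \<and> A n \<subseteq> I \<and>
    (\<forall>a \<in> A n. \<forall>b \<in> A n. c n a b \<in> A (Suc n)) \<and>
    (\<forall>a \<in> A n. (\<Oplus>b \<in> A n. c n a b \<otimes> b) = a)) \<and> (x \<in> I \<longrightarrow> x \<in> A 0)"
  have "\<exists>A c. ?Q x A c" for x
  proof (cases "x \<in> I")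
    case True
    then have "range (\<lambda>_ :: nat. x) \<subseteq> I" by auto
    from covered_sequence[OF I cov this] obtain A c
      where A: "\<And>n. finite (A n)" "\<And>n. A n \<subseteq> I" "\<And>n. A n \<subseteq> A (Suc n)" "\<And>n. x \<in> A n"
      and c: "\<And>n a. a \<in> A n \<Longrightarrow> c n a \<in> A n \<rightarrow> A (Suc n)"
        "\<And>n a. a \<in> A n \<Longrightarrow> a = (\<Oplus>b \<in> A n. c n a b \<otimes> b)"
      by blast
    have "c n a b \<in> A (Suc n)" if "a \<in> A n" "b \<in> A n" for n a b using c(1)[OF that(1)] that(2) by auto
    moreover have "(\<Oplus>b \<in> A n. c n a b \<otimes> b) = a" if "a \<in> A n" for n a using c(2)[OF that] ..
    ultimately show ?thesis using A(1,2,4) by (intro exI[of _ A] exI[of _ c]) simp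
  \<comment> \<open>Outside \<open>I\<close> all levels are empty, so \<open>shift\<close> and
    \<open>lift\<close> vanish on the basis elements of such a tree.\<close>
  qed (auto intro!: exI[of _ "\<lambda>_. {}"])
  then have "\<forall>x. \<exists>A c. ?Q x A c" by (rule allI)
  then have "\<exists>A c. \<forall>x. ?Q x (A x) (c x)" unfolding choice_iff .
  then obtain A c where Q: "\<forall>x. ?Q x (A x) (c x)" by (elim exE)
  have Ac: "\<And>x n. finite (A x n)" "\<And>x n. A x n \<subseteq> I"
      "\<And>x n a b. \<lbrakk>a \<in> A x n; b \<in> A x n\<rbrakk> \<Longrightarrow> c x n a b \<in> A x (Suc n)"
      "\<And>x n a. a \<in> A x n \<Longrightarrow> (\<Oplus>b \<in> A x n. c x n a b \<otimes> b) = a"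
      "\<And>x. x \<in> I \<Longrightarrow> x \<in> A x 0"
    using Q by simp_all
  interpret T: covering_tree I R A c
    by (intro covering_tree.intro covering_tree_axioms.intro I Ac)
  have "\<exists>P :: ('a, 'a \<times> nat \<Rightarrow> 'a) rmodule. projective_rmodule R P \<and> trace_ideal R P = I"
    using Ac(5) by (intro T.exists_projective exI)
  then show ?thesis by (auto intro: sym)
qed

theorem proposition2p6:
  fixes R :: "('a, 'c) ring_scheme" and I :: "'a set"
  assumes "ring R" and "ideal I R"
  shows
    "((\<exists>P :: ('a, 'a \<times> nat \<Rightarrow> 'a) rmodule. projective_rmodule R P \<and> I = trace_ideal R P)
        \<longleftrightarrow> finite_subsets_covered R I)
     \<and> ((\<exists>P :: ('a, 'p) rmodule. projective_rmodule R P \<and> I = trace_ideal R P)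
        \<longrightarrow> finite_subsets_covered R I)
     \<and> (finite_subsets_covered R I \<longleftrightarrow>
        (\<exists>J. left_ideal J R \<and> J \<subseteq> I \<and> J \<bullet>\<^bsub>R\<^esub> carrier R = I \<and> finite_subsets_covered R J))
     \<and> (finite_subsets_covered R I \<longrightarrow>
        (\<exists>F. (\<forall>K \<in> F. ideal K R \<and> is_sequence_union R K) \<and> aleph1_directed_union F I))"
proof -
  interpret ring R by fact
  interpret I: ideal I R by fact
  have left: "left_ideal I R" by (rule ideal_imp_left_ideal[OF assms(2)])
  \<comment> \<open>With this, \<open>I\<close> itself serves as the left ideal \<open>J\<close> in
    (iii).\<close>
  have IR: "I \<bullet>\<^bsub>R\<^esub> carrier R = I"
    using subgroup_prod_subset_ideal[OF assms(2) order_refl order_refl]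
      subset_subgroup_prod_carrier[OF I.a_subset] by (rule subset_antisym)
  show ?thesis
  proof (intro conjI iffI impI; (elim exE conjE)?)
    assume cov: "finite_subsets_covered R I"
    show "\<exists>P :: ('a, 'a \<times> nat \<Rightarrow> 'a) rmodule. projective_rmodule R P \<and> I = trace_ideal R P"
      by (rule covered_imp_projective_trace[OF assms(2) cov])
    show "\<exists>J. left_ideal J R \<and> J \<subseteq> I \<and> J \<bullet>\<^bsub>R\<^esub> carrier R = I \<and> finite_subsets_covered R J"
      by (intro exI[of _ I] conjI left order_refl IR cov)
    show "\<exists>F. (\<forall>K \<in> F. ideal K R \<and> is_sequence_union R K) \<and> aleph1_directed_union F I"
      by (intro exI[of _ "{K. ideal K R \<and> is_sequence_union R K \<and> K \<subseteq> I}"] conjI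
          covered_aleph1_directed_union[OF assms(2) cov]) auto
  qed (rule projective_trace_covered[OF _ assms(2)] finite_subsets_covered_ideal[OF assms(2)];
      assumption)+
qed

end
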